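(* Let $(X,\mathcal{A})$ be a compact $p$-adic analytic manifold with finite equalising atlas $\mathcal{A}$ with connected nerve graph and compact chart domains, $\omega$ a nowhere vanishing analytic differential $n$-form on $X$ and $\mu_X=|\omega|$. Let $s\in\mathbb{R}$ and $$\Delta^s h(x)=\int_X d_g(x,y)^{-s}\,(h(x)-h(y))\,|\omega(y)|.$$ The heat kernel function $$H(t,x,y)=1+\sum_{\psi}e^{-t\lambda_\psi}\psi(x)\overline{\psi(y)}$$ for $\Delta^s$, where $\psi$ runs over the wavelets on $X$ and $\lambda_\psi$ is the eigenvalue of $\Delta^s$ belonging to $\psi$, exists (i.e. the series converges) for $x\neq y\in X$, $t>0$. If $s>1$, then it also exists for $x=y$ and $t>0$, and $$H(t,\cdot,\cdot)\in L^2(X\times X,\mu_X\wedge\mu_X)$$ in this case, where $\mu_X\wedge\mu_X$ is the product measure.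
   Context: $K$ is a non-archimedean local field of residue characteristic $p$, with ring of integers $O_K$ and uniformiser $\pi$; $K^n$ carries the maximum norm and Haar measure $|dx|$. A $p$-adic analytic manifold $(X,\mathcal{A})$ of dimension $n$ is a Hausdorff space $X$ with an atlas $\mathcal{A}$ of charts $(U_\alpha,\phi_\alpha)$, $\phi_\alpha\colon U_\alpha\to K^n$ homeomorphisms onto open subsets, with bi-analytic transition maps $\tau_{\alpha\beta}\colon\phi_\alpha(U_\alpha\cap U_\beta)\to\phi_\beta(U_\alpha\cap U_\beta)$. For a locally bi-analytic map $F$ between open subsets of $K^n$, $e(F)$ is the smallest $N\in\mathbb{Z}$ such that $F$ takes balls of radius $p^{-N}$ to balls of the same radius, and $e(F)=-\infty$ if there is none. $\mathcal{A}$ is equalising if $\sup_{\alpha,\beta} e(\tau_{\alpha\beta})\ne-\infty$. Distinct charts are assumed to have distinct domains. Measure: in a chart write $\omega=f_\alpha\,dx_1\wedge\dots\wedge dx_n$ with $f_\alpha$ analytic; then $\mu_X(A)=\int_{\phi_\alpha(A)}|f_\alpha|\,|dx|$ for measurable $A\subseteq U_\alpha$. Nerve complex $N(\mathcal{A})$: its $k$-simplices are the non-empty intersections $U_J=\bigcap_{j\in J}U_j$ of chart domains with $|J|=k+1$; $U_J$ is a facet of $U_{J'}$ if $J\subset J'$. Simplices are identified with the corresponding subsets of $X$. The nerve graph is its $1$-skeleton. Ball: a set $B\subseteq X$ contained in a chart domain is a ball if for each chart $(U_\alpha,\phi_\alpha)$ with $B\subseteq U_\alpha$ the set $\phi_\alpha(B)$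 is a ball in $K^n$, and for any two charts with $B\subseteq U_\alpha\cap U_\beta$, $\tau_{\alpha\beta}$ takes $\phi_\alpha(B)$ to the ball $\phi_\beta(B)$ of equal radius. Join: $x\wedge y=\bigcap B$ over all balls $B\subseteq X$ containing $x$ and $y$, if such balls exist; otherwise undefined. Geodetic distance $d_g$: $d_g(x,y)=\mu_X(x\wedge y)$ if $x,y$ lie in a common ball in $X$, and otherwise $d_g(x,y)=\min_{\gamma\colon\sigma(x)\leadsto\sigma(y)}\mu_X(U_\gamma(x,y))$. Here $\sigma(x)$ is the highest-dimensional simplex of $N(\mathcal{A})$ containing $x$, $\gamma$ is a path in $N(\mathcal{A})$ from $\sigma(x)$ to $\sigma(y)$ through a sequence of adjacent faces of higher or lower dimension (of two consecutive simplices one is a facet of the other), and $U_\gamma(x,y)=\bigcup_{\sigma\in\gamma}\sigma\subseteq X$. Wavelet: a function $\psi\colon X\to\mathbb{C}$ supported on a ball $B(a)\subseteq X$ with $a\in X$ such that for any chart $(U_\alpha,\phi_\alpha)$ containing $B(a)$, the function $\psi_\alpha=\psi\circ\phi_\alpha^{-1}$ is a Kozyrev wavelet supported in a ball centred in $\phi_\alpha(a)\in K^n$. A Kozyrev wavelet supported on $b+\pi^mO_K^n$ is a constant multiple of $z\mapsto\chi(\pi^{-m-1}\,\eta\cdot z)\,1_{b+\pi^mO_K^n}(z)$, where $\chi$ is a fixed additive character of $K$ trivial on $O_K$ and non-trivial on $\pi^{-1}O_K$, and $\eta\in O_K^n$ represents a non-zero class in $(O_K/\pi O_K)^n$. Wavelets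 on $X$ are normalised to norm $1$ in $L^2(X,\mu_X)$, and the sum is over an orthonormal basis of $L^2(X,\mu_X)_w$ consisting of wavelets, where $L^2(X,\mu_X)_w$ is the closure of the span of the wavelets on $X$ with supports so small that they do not overlap (i.e. two supports are disjoint or nested). Each such $\psi$, with support $B$, is an eigenfunction of $\Delta^s$ with eigenvalue $\lambda_\psi=\int_{X\setminus B}d_g(x,y)^{-s}|\omega(y)|+\mu_X(B)^{1-s}$, for any $x\in B$. *)

theory Defs
  imports "HOL-Analysis.Analysis"
begin

section \<open>Non-archimedean local fields\<close>

text \<open>The absolute value is normalised so that a uniformiser has absolute value \<open>1/q\<close>, with
  \<open>q\<close> the cardinality of the residue field, i.e. \<open>|a|\<close> is the factor by which multiplication
  by \<open>a\<close> scales Haar measure. This is the normalisation for which \<open>|f| |dx|\<close> is compatible with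
  changes of charts. Completeness and finiteness of the residue field follow from the
  compactness of the valuation ring.\<close>

class nonarch_local_field = field + metric_space +
  fixes vabs :: "'a \<Rightarrow> real"
  assumes dist_vabs: "dist x y = vabs (x - y)"
    and vabs_eq_0_iff: "vabs x = 0 \<longleftrightarrow> x = 0"
    and vabs_mult: "vabs (x * y) = vabs x * vabs y"
    and vabs_add_le_max: "vabs (x + y) \<le> max (vabs x) (vabs y)"
    and vabs_nontrivial: "\<exists>x. x \<noteq> 0 \<and> vabs x \<noteq> 1"
    and compact_integers: "compact {x. vabs x \<le> 1}"
    and vabs_normalised:
      "\<exists>u. vabs u = 1 / real (card ({x. vabs x \<le> 1} //
                 {(x, y). vabs x \<le> 1 \<and> vabs y \<le> 1 \<and> vabs (x - y) < 1}))
           \<and> vabs u < 1 \<and> (\<forall>x. vabs x < 1 \<longrightarrow> vabs x \<le> vabs u)"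

definition int_ring :: "'k::nonarch_local_field set" where
  "int_ring = {x. vabs x \<le> 1}"

definition uniformiser :: "'k::nonarch_local_field \<Rightarrow> bool" where
  "uniformiser \<pi> \<longleftrightarrow> 0 < vabs \<pi> \<and> vabs \<pi> < 1 \<and> (\<forall>x :: 'k. vabs x < 1 \<longrightarrow> vabs x \<le> vabs \<pi>)"

definition residue_char :: "'k::nonarch_local_field itself \<Rightarrow> nat" where
  "residue_char _ = (LEAST m. 0 < m \<and> vabs (of_nat m :: 'k) < 1)"

definition additive_character :: "('k::nonarch_local_field \<Rightarrow> complex) \<Rightarrow> bool" where
  "additive_character chi \<longleftrightarrow>
     continuous_on UNIV chi \<and> (\<forall>x. norm (chi x) = 1) \<and> (\<forall>x y. chi (x + y) = chi x * chi y)"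

definition maxnorm :: "('k::nonarch_local_field) ^ 'n::finite \<Rightarrow> real" where
  "maxnorm z = Max (range (\<lambda>i. vabs (z $ i)))"

definition kball :: "('k::nonarch_local_field) ^ 'n::finite \<Rightarrow> real \<Rightarrow> ('k ^ 'n) set" where
  "kball a r = {z. maxnorm (z - a) \<le> r}"

definition haar_measure :: "(('k::nonarch_local_field) ^ 'n::finite) measure \<Rightarrow> bool" where
  "haar_measure H \<longleftrightarrow> sets H = sets borel
     \<and> (\<forall>a. \<forall>S\<in>sets borel. emeasure H ((+) a ` S) = emeasure H S)
     \<and> 0 < emeasure H (kball 0 1) \<and> emeasure H (kball 0 1) < \<infinity>"

section \<open>Analytic functions\<close>

text \<open>Multi-indices are functions \<open>'n \<Rightarrow> nat\<close>; over a non-archimedean field unconditional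
  summability amounts to the terms tending to \<open>0\<close>.\<close>

definition K_analytic_on ::
    "(('k::nonarch_local_field) ^ 'n::finite \<Rightarrow> 'k) \<Rightarrow> ('k ^ 'n) set \<Rightarrow> bool" where
  "K_analytic_on f S \<longleftrightarrow> (\<forall>a\<in>S. \<exists>r>0. \<exists>c :: ('n \<Rightarrow> nat) \<Rightarrow> 'k. kball a r \<subseteq> S \<and>
     (\<forall>z\<in>kball a r. ((\<lambda>k. c k * (\<Prod>i\<in>UNIV. (z $ i - a $ i) ^ k i)) has_sum f z) UNIV))"

definition K_analytic_map_on ::
    "(('k::nonarch_local_field) ^ 'n::finite \<Rightarrow> 'k ^ 'n) \<Rightarrow> ('k ^ 'n) set \<Rightarrow> bool" where
  "K_analytic_map_on F S \<longleftrightarrow> (\<forall>i. K_analytic_on (\<lambda>z. F z $ i) S)"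

definition bianalytic_on ::
    "(('k::nonarch_local_field) ^ 'n::finite \<Rightarrow> 'k ^ 'n) \<Rightarrow> ('k ^ 'n) set \<Rightarrow> bool" where
  "bianalytic_on F S \<longleftrightarrow>
     inj_on F S \<and> K_analytic_map_on F S \<and> K_analytic_map_on (inv_into S F) (F ` S)"

definition K_partial_deriv ::
    "'n::finite \<Rightarrow> (('k::nonarch_local_field) ^ 'n \<Rightarrow> 'k) \<Rightarrow> 'k ^ 'n \<Rightarrow> 'k" where
  "K_partial_deriv i f a = Lim (at 0) (\<lambda>h. (f (a + h *s axis i 1) - f a) / h)"

definition K_jacobian ::
    "(('k::nonarch_local_field) ^ 'n::finite \<Rightarrow> 'k ^ 'n) \<Rightarrow> 'k ^ 'n \<Rightarrow> 'k ^ 'n ^ 'n" where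
  "K_jacobian F a = (\<chi> i j. K_partial_deriv j (\<lambda>z. F z $ i) a)"

section \<open>Analytic manifolds\<close>

text \<open>A chart is a pair of its domain and its coordinate map; only the values of the coordinate
  map on the domain matter.\<close>

type_synonym ('x, 'k, 'n) chart = "'x set \<times> ('x \<Rightarrow> 'k ^ 'n)"

definition transition ::
    "('x, 'k, 'n::finite) chart \<Rightarrow> ('x, 'k, 'n) chart \<Rightarrow> 'k ^ 'n \<Rightarrow> 'k ^ 'n" where
  "transition a b = snd b \<circ> inv_into (fst a) (snd a)"

definition transition_dom ::
    "('x, 'k, 'n::finite) chart \<Rightarrow> ('x, 'k, 'n) chart \<Rightarrow> ('k ^ 'n) set" where
  "transition_dom a b = snd a ` (fst a \<inter> fst b)"

definition analytic_atlas ::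
    "('x::t2_space, 'k::nonarch_local_field, 'n::finite) chart set \<Rightarrow> bool" where
  "analytic_atlas A \<longleftrightarrow>
     (\<Union>a\<in>A. fst a) = UNIV \<and> inj_on fst A
     \<and> (\<forall>(U, \<phi>)\<in>A. open U \<and> open (\<phi> ` U) \<and> homeomorphism U (\<phi> ` U) \<phi> (inv_into U \<phi>))
     \<and> (\<forall>a\<in>A. \<forall>b\<in>A. bianalytic_on (transition a b) (transition_dom a b))"

text \<open>An exponent \<open>N\<close> counts only if some ball of radius \<open>p\<^sup>-\<^sup>N\<close> lies in the domain \<open>V\<close>; otherwise
  all sufficiently negative \<open>N\<close> would qualify vacuously for every bounded \<open>V\<close>.\<close>

definition equal_radius_exponents ::
    "(('k::nonarch_local_field) ^ 'n::finite) set \<Rightarrow> ('k ^ 'n \<Rightarrow> 'k ^ 'n) \<Rightarrow> int set" where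
  "equal_radius_exponents V F = {N. let r = real (residue_char TYPE('k)) powi (- N) in
     (\<exists>a. kball a r \<subseteq> V) \<and> (\<forall>a. kball a r \<subseteq> V \<longrightarrow> (\<exists>b. F ` kball a r = kball b r))}"

definition equal_exponent ::
    "(('k::nonarch_local_field) ^ 'n::finite) set \<Rightarrow> ('k ^ 'n \<Rightarrow> 'k ^ 'n) \<Rightarrow> ereal" where
  "equal_exponent V F =
     (if \<exists>N\<in>equal_radius_exponents V F. \<forall>M\<in>equal_radius_exponents V F. N \<le> M
      then ereal (real_of_int (LEAST N. N \<in> equal_radius_exponents V F)) else - \<infinity>)"

definition equalising ::
    "('x, 'k::nonarch_local_field, 'n::finite) chart set \<Rightarrow> bool" where
  "equalising A \<longleftrightarrow>
     (SUP a\<in>A. SUP b\<in>A. equal_exponent (transition_dom a b) (transition a b)) \<noteq> - \<infinity>"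

text \<open>A differential \<open>n\<close>-form is given by its coefficients \<open>f a\<close> in the charts \<open>a\<close>, which transform
  by the Jacobian determinant.\<close>

definition analytic_form ::
    "('x, 'k::nonarch_local_field, 'n::finite) chart set \<Rightarrow>
     (('x, 'k, 'n) chart \<Rightarrow> 'k ^ 'n \<Rightarrow> 'k) \<Rightarrow> bool" where
  "analytic_form A f \<longleftrightarrow>
     (\<forall>a\<in>A. K_analytic_on (f a) (snd a ` fst a))
     \<and> (\<forall>a\<in>A. \<forall>b\<in>A. \<forall>z\<in>transition_dom a b.
          f a z = f b (transition a b z) * det (K_jacobian (transition a b) z))"

definition nowhere_vanishing ::
    "('x, 'k::nonarch_local_field, 'n::finite) chart set \<Rightarrow>
     (('x, 'k, 'n) chart \<Rightarrow> 'k ^ 'n \<Rightarrow> 'k) \<Rightarrow> bool" where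
  "nowhere_vanishing A f \<longleftrightarrow> (\<forall>a\<in>A. \<forall>z\<in>snd a ` fst a. f a z \<noteq> 0)"

text \<open>\<open>\<mu> = |\<omega>|\<close>. Since finitely many charts cover the space, this determines \<open>\<mu>\<close>.\<close>

definition form_measure ::
    "('x::t2_space, 'k::nonarch_local_field, 'n::finite) chart set \<Rightarrow> ('k ^ 'n) measure \<Rightarrow>
     (('x, 'k, 'n) chart \<Rightarrow> 'k ^ 'n \<Rightarrow> 'k) \<Rightarrow> 'x measure \<Rightarrow> bool" where
  "form_measure A H f \<mu> \<longleftrightarrow> sets \<mu> = sets borel
     \<and> (\<forall>a\<in>A. \<forall>S\<in>sets borel. S \<subseteq> fst a \<longrightarrow>
          emeasure \<mu> S = (\<integral>\<^sup>+z\<in>snd a ` S. ennreal (vabs (f a z)) \<partial>H))"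

section \<open>Nerve complex, balls and geodetic distance\<close>

text \<open>The simplex \<open>U\<^sub>J\<close> is represented by its set \<open>J\<close> of charts.\<close>

definition simplex_set :: "('x, 'k, 'n::finite) chart set \<Rightarrow> 'x set" where
  "simplex_set J = (\<Inter>a\<in>J. fst a)"

definition nerve :: "('x, 'k, 'n::finite) chart set \<Rightarrow> ('x, 'k, 'n) chart set set" where
  "nerve A = {J. J \<subseteq> A \<and> finite J \<and> J \<noteq> {} \<and> simplex_set J \<noteq> {}}"

definition nerve_graph_connected :: "('x, 'k, 'n::finite) chart set \<Rightarrow> bool" where
  "nerve_graph_connected A \<longleftrightarrow>
     (\<forall>a b. {a} \<in> nerve A \<and> {b} \<in> nerve A \<longrightarrow>
        (a, b) \<in> {(c, d). c \<noteq> d \<and> {c, d} \<in> nerve A}\<^sup>*)"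

definition is_nerve_path ::
    "('x, 'k, 'n::finite) chart set \<Rightarrow> ('x, 'k, 'n) chart set list \<Rightarrow> bool" where
  "is_nerve_path A \<gamma> \<longleftrightarrow> \<gamma> \<noteq> [] \<and> set \<gamma> \<subseteq> nerve A \<and>
     (\<forall>i. Suc i < length \<gamma> \<longrightarrow> \<gamma> ! i \<subset> \<gamma> ! Suc i \<or> \<gamma> ! Suc i \<subset> \<gamma> ! i)"

text \<open>The highest-dimensional simplex containing \<open>x\<close>.\<close>

definition point_simplex ::
    "('x, 'k, 'n::finite) chart set \<Rightarrow> 'x \<Rightarrow> ('x, 'k, 'n) chart set" where
  "point_simplex A x = {a\<in>A. x \<in> fst a}"

text \<open>The radius is taken in the value group of \<open>K\<close>, so it is determined by the ball, and the same
  radius is required in all charts whose domain contains the ball.\<close>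

definition is_ball ::
    "('x, 'k::nonarch_local_field, 'n::finite) chart set \<Rightarrow> real \<Rightarrow> 'x set \<Rightarrow> bool" where
  "is_ball A r B \<longleftrightarrow> r \<in> vabs ` (- {0 :: 'k}) \<and> (\<exists>a\<in>A. B \<subseteq> fst a)
     \<and> (\<forall>a\<in>A. B \<subseteq> fst a \<longrightarrow> (\<exists>b. snd a ` B = kball b r))"

definition join_set ::
    "('x, 'k::nonarch_local_field, 'n::finite) chart set \<Rightarrow> 'x \<Rightarrow> 'x \<Rightarrow> 'x set" where
  "join_set A x y = \<Inter>{B. (\<exists>r. is_ball A r B) \<and> x \<in> B \<and> y \<in> B}"

definition geodetic_dist ::
    "('x, 'k::nonarch_local_field, 'n::finite) chart set \<Rightarrow> 'x measure \<Rightarrow> 'x \<Rightarrow> 'x \<Rightarrow> real" where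
  "geodetic_dist A \<mu> x y =
     (if \<exists>r B. is_ball A r B \<and> x \<in> B \<and> y \<in> B then measure \<mu> (join_set A x y)
      else Min {measure \<mu> (\<Union>J\<in>set \<gamma>. simplex_set J) | \<gamma>. is_nerve_path A \<gamma>
                  \<and> hd \<gamma> = point_simplex A x \<and> last \<gamma> = point_simplex A y})"

section \<open>The operator, wavelets and the heat kernel\<close>

definition Delta_op ::
    "('x, 'k::nonarch_local_field, 'n::finite) chart set \<Rightarrow> 'x measure \<Rightarrow> real \<Rightarrow>
     ('x \<Rightarrow> complex) \<Rightarrow> 'x \<Rightarrow> complex" where
  "Delta_op A \<mu> s h x =
     (LINT y|\<mu>. complex_of_real (geodetic_dist A \<mu> x y powr (- s)) * (h x - h y))"

text \<open>The integrability clause says that \<open>\<Delta>\<^sup>s h (x)\<close> exists as a Lebesgue integral.\<close>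

definition eigenvalue_for ::
    "('x, 'k::nonarch_local_field, 'n::finite) chart set \<Rightarrow> 'x measure \<Rightarrow> real \<Rightarrow>
     ('x \<Rightarrow> complex) \<Rightarrow> real \<Rightarrow> bool" where
  "eigenvalue_for A \<mu> s h l \<longleftrightarrow> (\<exists>x. h x \<noteq> 0) \<and>
     (\<forall>x. integrable \<mu>
             (\<lambda>y. complex_of_real (geodetic_dist A \<mu> x y powr (- s)) * (h x - h y))
          \<and> Delta_op A \<mu> s h x = complex_of_real l * h x)"

text \<open>Kozyrev wavelets supported on \<open>b + \<pi>\<^sup>m O\<^sup>n\<close>.\<close>

definition kozyrev_wavelet ::
    "'k::nonarch_local_field \<Rightarrow> ('k \<Rightarrow> complex) \<Rightarrow> 'k ^ 'n::finite \<Rightarrow> int \<Rightarrow>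
     ('k ^ 'n \<Rightarrow> complex) \<Rightarrow> bool" where
  "kozyrev_wavelet \<pi> chi b m g \<longleftrightarrow>
     (\<exists>c \<eta>. (\<forall>i. \<eta> $ i \<in> int_ring) \<and> (\<exists>i. \<eta> $ i \<notin> (\<lambda>u. \<pi> * u) ` int_ring)
        \<and> g = (\<lambda>z. c * chi (\<pi> powi (- m - 1) * (\<Sum>i\<in>UNIV. \<eta> $ i * z $ i))
                     * indicator (kball b (vabs (\<pi> powi m))) z))"

text \<open>Normalised wavelets with support the ball \<open>B\<close>. The function \<open>\<psi> \<circ> \<phi>\<^sup>-\<^sup>1\<close>, which lives
  on the image of the chart, is compared with a Kozyrev wavelet there.\<close>

definition wavelet_on ::
    "('x, 'k::nonarch_local_field, 'n::finite) chart set \<Rightarrow> 'k \<Rightarrow> ('k \<Rightarrow> complex) \<Rightarrow>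
     'x measure \<Rightarrow> 'x set \<Rightarrow> ('x \<Rightarrow> complex) \<Rightarrow> bool" where
  "wavelet_on A \<pi> chi \<mu> B \<psi> \<longleftrightarrow>
     (\<exists>r. is_ball A r B) \<and> (\<forall>x. x \<notin> B \<longrightarrow> \<psi> x = 0)
     \<and> (\<exists>x0\<in>B. \<forall>a\<in>A. B \<subseteq> fst a \<longrightarrow>
          (\<exists>m g. kozyrev_wavelet \<pi> chi (snd a x0) m g
             \<and> snd a ` B = kball (snd a x0) (vabs (\<pi> powi m))
             \<and> (\<forall>z\<in>snd a ` fst a. (\<psi> \<circ> inv_into (fst a) (snd a)) z = g z)))
     \<and> (LINT x|\<mu>. complex_of_real ((norm (\<psi> x))\<^sup>2)) = 1"

definition wavelets ::
    "('x, 'k::nonarch_local_field, 'n::finite) chart set \<Rightarrow> 'k \<Rightarrow> ('k \<Rightarrow> complex) \<Rightarrow>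
     'x measure \<Rightarrow> ('x \<Rightarrow> complex) set" where
  "wavelets A \<pi> chi \<mu> = {\<psi>. \<exists>B. wavelet_on A \<pi> chi \<mu> B \<psi>}"

text \<open>Wavelets supported on balls of radius at most \<open>\<rho>\<close>.\<close>

definition small_wavelets ::
    "('x, 'k::nonarch_local_field, 'n::finite) chart set \<Rightarrow> 'k \<Rightarrow> ('k \<Rightarrow> complex) \<Rightarrow>
     'x measure \<Rightarrow> real \<Rightarrow> ('x \<Rightarrow> complex) set" where
  "small_wavelets A \<pi> chi \<mu> \<rho> =
     {\<psi>. \<exists>B r. r \<le> \<rho> \<and> is_ball A r B \<and> wavelet_on A \<pi> chi \<mu> B \<psi>}"

definition non_overlapping :: "('x \<Rightarrow> complex) set \<Rightarrow> bool" where
  "non_overlapping S \<longleftrightarrow> (\<forall>\<psi>\<in>S. \<forall>\<psi>'\<in>S. let B = {x. \<psi> x \<noteq> 0}; B' = {x. \<psi>' x \<noteq> 0} in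
     B \<inter> B' = {} \<or> B \<subseteq> B' \<or> B' \<subseteq> B)"

text \<open>Elements of \<open>L\<^sup>2\<close> are represented by functions.\<close>

definition square_integrable :: "'y measure \<Rightarrow> ('y \<Rightarrow> complex) \<Rightarrow> bool" where
  "square_integrable M h \<longleftrightarrow> h \<in> borel_measurable M \<and> integrable M (\<lambda>x. (norm (h x))\<^sup>2)"

definition L2_closed_span :: "'x measure \<Rightarrow> ('x \<Rightarrow> complex) set \<Rightarrow> ('x \<Rightarrow> complex) set" where
  "L2_closed_span \<mu> S = {h. square_integrable \<mu> h \<and>
     (\<forall>\<epsilon>>0. \<exists>F c. finite F \<and> F \<subseteq> S \<and>
        (LINT x|\<mu>. (norm (h x - (\<Sum>\<psi>\<in>F. c \<psi> * \<psi> x)))\<^sup>2) < \<epsilon>)}"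

definition L2_orthonormal :: "'x measure \<Rightarrow> ('x \<Rightarrow> complex) set \<Rightarrow> bool" where
  "L2_orthonormal \<mu> W \<longleftrightarrow> (\<forall>\<psi>\<in>W. square_integrable \<mu> \<psi>) \<and>
     (\<forall>\<psi>\<in>W. \<forall>\<psi>'\<in>W. (LINT x|\<mu>. \<psi> x * cnj (\<psi>' x)) = (if \<psi> = \<psi>' then 1 else 0))"

definition heat_term ::
    "(('x \<Rightarrow> complex) \<Rightarrow> real) \<Rightarrow> real \<Rightarrow> 'x \<Rightarrow> 'x \<Rightarrow> ('x \<Rightarrow> complex) \<Rightarrow> complex" where
  "heat_term lam t x y \<psi> = complex_of_real (exp (- t * lam \<psi>)) * \<psi> x * cnj (\<psi> y)"

definition heat_kernel ::
    "('x \<Rightarrow> complex) set \<Rightarrow> (('x \<Rightarrow> complex) \<Rightarrow> real) \<Rightarrow> real \<Rightarrow> 'x \<Rightarrow> 'x \<Rightarrow> complex" where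
  "heat_kernel W lam t x y = 1 + infsum (heat_term lam t x y) W"

end

theory Submission
  imports Defs
begin

text \<open>The wavelets of the family are supported on balls, and the proof is a matter of counting these
  balls by their volumes.

  Two wavelets of an orthonormal family that live on the same ball and whose frequencies agree modulo
  \<open>\<pi>\<close> are equal, since they are proportional (\<open>same_class_overlapping_imp_eq\<close>). As there are finitely
  many residue classes of frequencies, the supports of one chart and one radius have bounded total
  volume. The volumes themselves decay geometrically with the radius: the density \<open>|f|\<close> of the form
  is bounded, and Haar measure at least halves from one radius to the next. Therefore the squares of
  the volumes are summable over all wavelets (\<open>summable_measure_sq\<close>), and in particular only finitely
  many supports exceed a given volume.

  Off the diagonal this already suffices. A support that contains two distinct points contains their
  join, which contains a neighbourhood of one of them and so is not a null set; hence only finitely many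
  terms of the series are nonzero.

  On the diagonal the eigenvalues enter. The absolute value of a nowhere vanishing analytic function is
  locally constant, hence the density is constant on all but finitely many of the supports \<open>B\<close>. There
  the wavelet has mean zero, and the eigenvalue equation, divided by the value of the wavelet at a point
  of \<open>B\<close>, yields \<open>\<lambda> \<ge> \<mu>(B)\<^sup>1\<^sup>-\<^sup>s\<close> (\<open>eigenvalue_lower_bound\<close>). As \<open>|\<psi>|\<^sup>2 = 1 / \<mu>(B)\<close> on \<open>B\<close>, for
  \<open>s > 1\<close> the terms of the series are at most \<open>exp (- t \<mu>(B)\<^sup>1\<^sup>-\<^sup>s) / \<mu>(B)\<close>, which is at most a
  constant times \<open>\<mu>(B)\<^sup>2\<close>. So the series converges uniformly on \<open>X \<times> X\<close>, and the heat kernel is a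
  bounded measurable function on a space of finite measure.\<close>

section \<open>The absolute value and balls in the model space\<close>

lemma vabs_nonneg [simp]: "0 \<le> vabs (x :: 'k::nonarch_local_field)"
  using zero_le_dist[of x 0] by (simp add: dist_vabs)

lemma vabs_zero [simp]: "vabs (0 :: 'k::nonarch_local_field) = 0"
  by (simp add: vabs_eq_0_iff)

lemma vabs_pos_iff [simp]: "0 < vabs (x :: 'k::nonarch_local_field) \<longleftrightarrow> x \<noteq> 0"
  using vabs_nonneg[of x] by (simp add: less_le vabs_eq_0_iff eq_commute[of 0])

lemma vabs_one [simp]: "vabs (1 :: 'k::nonarch_local_field) = 1"
  using vabs_mult[of "1::'k" 1] vabs_eq_0_iff[of "1::'k"] by simp

lemma vabs_minus_commute: "vabs (x - y :: 'k::nonarch_local_field) = vabs (y - x)"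
  using dist_commute[of x y] by (simp add: dist_vabs)

lemma vabs_minus [simp]: "vabs (- x :: 'k::nonarch_local_field) = vabs x"
  using vabs_minus_commute[of 0 x] by simp

lemma vabs_diff_le_max: "vabs (x - y :: 'k::nonarch_local_field) \<le> max (vabs x) (vabs y)"
  using vabs_add_le_max[of x "- y"] by simp

lemma vabs_inverse: "vabs (inverse x :: 'k::nonarch_local_field) = inverse (vabs x)"
proof (cases "x = 0")
  case False
  then have "vabs x * vabs (inverse x) = 1"
    by (simp flip: vabs_mult)
  then show ?thesis
    by (metis inverse_unique)
qed simp

lemma vabs_divide: "vabs (x / y :: 'k::nonarch_local_field) = vabs x / vabs y"
  by (simp add: divide_inverse vabs_mult vabs_inverse)

lemma vabs_power: "vabs (x ^ m :: 'k::nonarch_local_field) = vabs x ^ m"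
  by (induction m) (simp_all add: vabs_mult)

lemma vabs_power_int: "vabs (x powi m :: 'k::nonarch_local_field) = vabs x powi m"
  by (simp add: power_int_def vabs_power vabs_inverse)

lemma vabs_prod: "vabs (\<Prod>i\<in>I. f i :: 'k::nonarch_local_field) = (\<Prod>i\<in>I. vabs (f i))"
  by (induction I rule: infinite_finite_induct) (simp_all add: vabs_mult)

lemma vabs_sum_le:
  assumes "\<And>i. i \<in> I \<Longrightarrow> vabs (f i :: 'k::nonarch_local_field) \<le> C" "0 \<le> C"
  shows "vabs (\<Sum>i\<in>I. f i) \<le> C"
  using assms
proof (induction I rule: infinite_finite_induct)
  case (insert i I)
  then show ?case
    using vabs_add_le_max[of "f i" "sum f I"] by fastforce
qed auto

text \<open>Every ultrametric triangle is isosceles, with the two longer sides equal.\<close>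

lemma vabs_eq_of_near:
  assumes "vabs (x - y :: 'k::nonarch_local_field) < vabs y"
  shows "vabs x = vabs y"
  using vabs_add_le_max[of "x - y" y] vabs_diff_le_max[of x "x - y"] assms
  by (auto simp: max_def split: if_splits)

lemma maxnorm_le_iff: "maxnorm z \<le> r \<longleftrightarrow> (\<forall>i. vabs (z $ i) \<le> r)"
  unfolding maxnorm_def by (subst Max_le_iff) auto

lemma kball_iff: "z \<in> kball a r \<longleftrightarrow> (\<forall>i. vabs (z $ i - a $ i) \<le> r)"
  by (simp add: kball_def maxnorm_le_iff)

lemma kball_mono: "r \<le> r' \<Longrightarrow> kball a r \<subseteq> kball a r'"
  unfolding kball_iff subset_iff by (meson order_trans)

lemma centre_in_kball: "0 \<le> r \<Longrightarrow> a \<in> kball a r"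
  by (simp add: kball_iff)

lemma kball_recentre:
  assumes "z \<in> kball a r"
  shows "kball z r = kball a r"
proof -
  have sub: "kball z r \<subseteq> kball a r" if "z \<in> kball a r" for z a :: "'a ^ 'b"
  proof
    fix w assume w: "w \<in> kball z r"
    show "w \<in> kball a r"
      unfolding kball_iff
    proof
      fix i
      have "vabs (w $ i - a $ i) \<le> max (vabs (w $ i - z $ i)) (vabs (z $ i - a $ i))"
        using vabs_add_le_max[of "w $ i - z $ i" "z $ i - a $ i"] by simp
      with w that show "vabs (w $ i - a $ i) \<le> r"
        by (meson kball_iff max.boundedI order_trans)
    qed
  qed
  have "a \<in> kball z r"
    using assms by (simp add: kball_iff vabs_minus_commute)
  with sub[of z a] sub[of a z] assms show ?thesis by blast
qed

lemma kball_meet_imp_eq: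
  assumes "kball a r \<inter> kball b r \<noteq> {}"
  shows "kball a r = kball b r"
  using assms kball_recentre by blast

lemma kball_translate: "(+) h ` kball a r = kball (h + a) r"
proof
  show "kball (h + a) r \<subseteq> (+) h ` kball a r"
  proof
    fix z assume "z \<in> kball (h + a) r"
    then have "z - h \<in> kball a r"
      by (simp add: kball_iff algebra_simps)
    then show "z \<in> (+) h ` kball a r"
      by (metis add.commute diff_add_cancel imageI)
  qed
qed (auto simp: kball_iff)

lemma dist_le_kball:
  fixes a z :: "('k::nonarch_local_field) ^ 'n::finite"
  assumes "z \<in> kball a r"
  shows "dist z a \<le> real CARD('n) * r"
proof -
  have "dist z a \<le> (\<Sum>i\<in>UNIV. dist (z $ i) (a $ i))"
    unfolding dist_vec_def by (rule L2_set_le_sum) simp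
  also have "\<dots> \<le> (\<Sum>i\<in>(UNIV::'n set). r)"
    using assms by (intro sum_mono) (auto simp: dist_vabs kball_iff)
  finally show ?thesis by simp
qed

lemma cball_subset_kball: "cball a r \<subseteq> kball a r"
proof
  fix z assume "z \<in> cball a r"
  then have "dist (z $ i) (a $ i) \<le> r" for i
    using dist_vec_nth_le[of z i a] by (auto simp: dist_commute)
  then show "z \<in> kball a r"
    by (simp add: kball_iff dist_vabs)
qed

text \<open>The metric on vectors is Euclidean; its balls and those of the maximum norm contain each other
  after rescaling by the dimension, so they define the same topology.\<close>

lemma open_contains_kball:
  fixes S :: "(('k::nonarch_local_field) ^ 'n::finite) set"
  assumes "open S" "z \<in> S"
  obtains r where "0 < r" "kball z r \<subseteq> S"
proof -
  obtain e where e: "0 < e" "ball z e \<subseteq> S"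
    using assms openE by blast
  define r where "r = e / (2 * real CARD('n))"
  have "real CARD('n) * r < e"
    using e(1) by (simp add: r_def field_simps)
  then have "kball z r \<subseteq> ball z e"
    using dist_le_kball by (fastforce simp: dist_commute)
  with e show thesis
    by (intro that[of r]) (auto simp: r_def)
qed

lemma open_kball: "0 < r \<Longrightarrow> open (kball a r)"
  unfolding open_contains_cball using cball_subset_kball kball_recentre by blast

lemma closed_kball: "closed (kball a r)"
proof (cases "0 < r")
  case True
  have "kball z r \<subseteq> - kball a r" if "z \<in> - kball a r" for z
    using that kball_meet_imp_eq[of z r a] centre_in_kball[of r z] True by auto
  then show ?thesis
    using cball_subset_kball True unfolding closed_def open_contains_cball by blast
next
  case False
  have "z = a" if "z \<in> kball a r" for z
  proof -
    have "vabs (z $ i - a $ i) \<le> 0" for i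
      using that False by (meson kball_iff not_le_imp_less order.strict_implies_order order_trans)
    then show ?thesis
      using vabs_pos_iff by (metis eq_iff_diff_eq_0 not_le vec_eq_iff)
  qed
  then have "kball a r \<subseteq> {a}" by blast
  then have "finite (kball a r)"
    by (rule finite_subset) simp
  then show ?thesis by (rule finite_imp_closed)
qed

lemma kball_borel [measurable, simp]: "kball a r \<in> sets borel"
  using closed_kball by (rule borel_closed)

lemma continuous_translate:
  "continuous_on UNIV ((+) (h :: ('k::nonarch_local_field) ^ 'n::finite))"
proof -
  have "dist (h + x) (h + y) = dist x y" for x y :: "'k ^ 'n"
    by (simp add: dist_vec_def dist_vabs)
  then show ?thesis
    unfolding continuous_on_iff by auto
qed

lemma uniformiser_pow:
  assumes "uniformiser \<pi>"
  shows "\<pi> \<noteq> 0" "vabs \<pi> > 0" "vabs \<pi> < 1" "vabs (\<pi> powi m) > 0"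
    and "m \<le> m' \<Longrightarrow> vabs (\<pi> powi m') \<le> vabs (\<pi> powi m)"
    and "vabs (\<pi> powi (m + 1)) = vabs \<pi> * vabs (\<pi> powi m)"
proof -
  show 0: "\<pi> \<noteq> 0" and 1: "vabs \<pi> > 0" and 2: "vabs \<pi> < 1"
    using assms by (auto simp: uniformiser_def)
  show "vabs (\<pi> powi m) > 0" using 0 by simp
  show "vabs (\<pi> powi m') \<le> vabs (\<pi> powi m)" if "m \<le> m'"
    using that 1 2 unfolding vabs_power_int by (intro power_int_decreasing) linarith+
  show "vabs (\<pi> powi (m + 1)) = vabs \<pi> * vabs (\<pi> powi m)"
    using 0 by (simp add: power_int_add vabs_mult)
qed

lemma small_uniformiser_pow:
  assumes "uniformiser \<pi>" "0 < r"
  obtains k :: nat where "vabs (\<pi> powi int k) \<le> r"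
proof -
  obtain k where "vabs \<pi> ^ k < r"
    using real_arch_pow_inv uniformiser_pow(3)[OF assms(1)] assms(2) by blast
  then show thesis
    by (intro that[of k]) (simp add: vabs_power)
qed

lemma large_uniformiser_pow:
  assumes "uniformiser \<pi>"
  obtains k :: int where "r < vabs (\<pi> powi k)"
proof -
  have "inverse (vabs \<pi>) > 1"
    using uniformiser_pow[OF assms] by (simp add: one_less_inverse)
  then obtain k where "r < inverse (vabs \<pi>) ^ k"
    using real_arch_pow by blast
  then show thesis
    by (intro that[of "- int k"]) (simp add: power_int_minus vabs_inverse vabs_power power_inverse)
qed

section \<open>Haar measure of balls\<close>

lemma finite_residue_representatives:
  fixes \<pi> :: "'k::nonarch_local_field"
  assumes "uniformiser \<pi>"
  obtains R :: "('k ^ 'n::finite) set" where "finite R"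
    "\<And>z. (\<And>i. z $ i \<in> int_ring) \<Longrightarrow> \<exists>w\<in>R. z \<in> kball w (vabs \<pi>)"
proof -
  obtain T where T: "finite T" "(int_ring :: 'k set) \<subseteq> (\<Union>x\<in>T. ball x (vabs \<pi>))"
    using compact_integers uniformiser_pow(2)[OF assms]
    unfolding compact_eq_totally_bounded int_ring_def by blast
  define R :: "('k ^ 'n) set" where "R = vec_lambda ` (UNIV \<rightarrow>\<^sub>E T)"
  show thesis
  proof (rule that)
    show "finite R"
      unfolding R_def by (intro finite_imageI finite_PiE) (auto simp: T)
    fix z :: "'k ^ 'n" assume "\<And>i. z $ i \<in> int_ring"
    then have "\<forall>i. z $ i \<in> (\<Union>x\<in>T. ball x (vabs \<pi>))"
      using T(2) by blast
    then have "\<forall>i. \<exists>x\<in>T. vabs (z $ i - x) \<le> vabs \<pi>"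
      by (auto simp: dist_vabs vabs_minus_commute[of "z $ _"] intro: less_imp_le)
    then obtain g where g: "\<And>i. g i \<in> T" "\<And>i. vabs (z $ i - g i) \<le> vabs \<pi>"
      by metis
    then have "vec_lambda g \<in> R" "z \<in> kball (vec_lambda g) (vabs \<pi>)"
      by (auto simp: R_def kball_iff)
    then show "\<exists>w\<in>R. z \<in> kball w (vabs \<pi>)" by blast
  qed
qed

locale haar_setting =
  fixes H :: "(('k::nonarch_local_field) ^ 'n::finite) measure" and \<pi> :: 'k
  assumes haar: "haar_measure H" and uniformiser: "uniformiser \<pi>"
begin

lemmas pi_pow = uniformiser_pow[OF uniformiser]

lemma sets_H [measurable_cong, simp]: "sets H = sets borel"
  using haar by (simp add: haar_measure_def)

lemma translation_invariant: "S \<in> sets borel \<Longrightarrow> emeasure H ((+) h ` S) = emeasure H S"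
  using haar by (simp add: haar_measure_def)

lemma emeasure_kball_centre: "emeasure H (kball a r) = emeasure H (kball 0 r)"
  using translation_invariant[of "kball 0 r" a] by (simp add: kball_translate)

text \<open>A ball is a disjoint union of balls of the next smaller radius, one for each residue class of
  vectors. There are at least two classes, those of \<open>0\<close> and of the all-ones vector, which makes the
  volumes decay geometrically; and there are finitely many, which keeps them positive and finite.\<close>

lemma twice_emeasure_next_kball:
  "2 * emeasure H (kball 0 (vabs (\<pi> powi (m + 1)))) \<le> emeasure H (kball 0 (vabs (\<pi> powi m)))"
proof -
  let ?r = "vabs (\<pi> powi (m + 1))" and ?b = "\<chi> i. \<pi> powi m :: 'k ^ 'n"
  have less: "?r < vabs (\<pi> powi m)"
    using pi_pow(1,3) pi_pow(4)[of m] by (simp only: pi_pow(6)) simp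
  have disj: "kball 0 ?r \<inter> kball ?b ?r = {}"
  proof (rule ccontr)
    assume "kball 0 ?r \<inter> kball ?b ?r \<noteq> {}"
    then have "?b \<in> kball 0 ?r"
      using kball_meet_imp_eq[of 0 ?r ?b] centre_in_kball[of ?r ?b] by simp
    with less show False by (simp add: kball_iff)
  qed
  have "kball ?b (vabs (\<pi> powi m)) = kball 0 (vabs (\<pi> powi m))"
    by (rule kball_recentre) (simp add: kball_iff)
  then have sub: "kball 0 ?r \<union> kball ?b ?r \<subseteq> kball 0 (vabs (\<pi> powi m))"
    using kball_mono less by (metis Un_least less_imp_le)
  have "2 * emeasure H (kball 0 ?r) = emeasure H (kball 0 ?r) + emeasure H (kball ?b ?r)"
    by (simp add: emeasure_kball_centre[of ?b] mult_2)
  also have "\<dots> = emeasure H (kball 0 ?r \<union> kball ?b ?r)"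
    using disj by (intro plus_emeasure) auto
  also have "\<dots> \<le> emeasure H (kball 0 (vabs (\<pi> powi m)))"
    using sub by (intro emeasure_mono) auto
  finally show ?thesis .
qed

lemma emeasure_kball_le_next:
  obtains N :: nat where "\<And>m. emeasure H (kball 0 (vabs (\<pi> powi m)))
      \<le> of_nat N * emeasure H (kball 0 (vabs (\<pi> powi (m + 1))))"
proof -
  obtain R :: "('k ^ 'n) set" where R: "finite R"
    "\<And>z. (\<And>i. z $ i \<in> int_ring) \<Longrightarrow> \<exists>w\<in>R. z \<in> kball w (vabs \<pi>)"
    using finite_residue_representatives[OF uniformiser] by blast
  have "emeasure H (kball 0 (vabs (\<pi> powi m)))
      \<le> of_nat (card R) * emeasure H (kball 0 (vabs (\<pi> powi (m + 1))))" for m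
  proof -
    let ?r = "vabs (\<pi> powi (m + 1))" and ?s = "\<lambda>w :: 'k ^ 'n. \<chi> i. \<pi> powi m * w $ i"
    have sub: "kball 0 (vabs (\<pi> powi m)) \<subseteq> (\<Union>w\<in>R. kball (?s w) ?r)"
    proof
      fix z :: "'k ^ 'n" assume z: "z \<in> kball 0 (vabs (\<pi> powi m))"
      have "(\<chi> i. z $ i / \<pi> powi m) $ i \<in> int_ring" for i
        using z pi_pow(4)[of m] by (simp add: int_ring_def vabs_divide kball_iff)
      then obtain w where w: "w \<in> R" "(\<chi> i. z $ i / \<pi> powi m) \<in> kball w (vabs \<pi>)"
        using R(2) by blast
      have "vabs (z $ i - \<pi> powi m * w $ i) \<le> ?r" for i
      proof -
        have "z $ i - \<pi> powi m * w $ i = \<pi> powi m * (z $ i / \<pi> powi m - w $ i)"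
          using pi_pow(1) by (simp add: field_simps)
        then have "vabs (z $ i - \<pi> powi m * w $ i)
            = vabs (\<pi> powi m) * vabs (z $ i / \<pi> powi m - w $ i)"
          by (simp add: vabs_mult)
        also have "\<dots> \<le> vabs (\<pi> powi m) * vabs \<pi>"
          using w(2) by (intro mult_left_mono) (auto simp: kball_iff)
        finally show ?thesis by (simp add: pi_pow(6) mult.commute)
      qed
      with w(1) show "z \<in> (\<Union>w\<in>R. kball (?s w) ?r)"
        by (auto simp: kball_iff)
    qed
    have "emeasure H (kball 0 (vabs (\<pi> powi m))) \<le> emeasure H (\<Union>w\<in>R. kball (?s w) ?r)"
      using sub R(1) by (intro emeasure_mono) auto
    also have "\<dots> \<le> (\<Sum>w\<in>R. emeasure H (kball (?s w) ?r))"
      using R(1) by (intro emeasure_subadditive_finite) auto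
    also have "\<dots> = of_nat (card R) * emeasure H (kball 0 ?r)"
      by (subst emeasure_kball_centre) simp
    finally show ?thesis .
  qed
  then show thesis by (rule that)
qed

lemma emeasure_kball_pi_pow:
  "0 < emeasure H (kball a (vabs (\<pi> powi m))) \<and> emeasure H (kball a (vabs (\<pi> powi m))) < \<infinity>"
proof -
  let ?h = "\<lambda>m. emeasure H (kball 0 (vabs (\<pi> powi m)))"
  obtain N where N: "?h m \<le> of_nat N * ?h (m + 1)" for m
    using emeasure_kball_le_next by blast
  have mono: "?h (m + 1) \<le> ?h m" for m
    by (intro emeasure_mono kball_mono pi_pow(5)) auto
  have "0 < ?h m \<and> ?h m < \<infinity>"
  proof (induction m rule: int_induct[of _ 0])
    case base
    then show ?case using haar by (simp add: haar_measure_def)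
  next
    case (step1 m)
    then show ?case
      using N[of m] mono[of m] by (auto simp: zero_less_iff_neq_zero)
  next
    case (step2 m)
    have "of_nat N < (top::ennreal)"
      by (simp add: ennreal_of_nat_eq_real_of_nat)
    then have "of_nat N * ?h m < \<infinity>"
      using step2 by (simp add: ennreal_mult_less_top)
    then show ?case
      using N[of "m - 1"] mono[of "m - 1"] step2 by (auto simp: zero_less_iff_neq_zero)
  qed
  then show ?thesis by (simp add: emeasure_kball_centre[of a])
qed

lemma emeasure_kball_pos:
  assumes "0 < r"
  shows "0 < emeasure H (kball a r)"
proof -
  obtain k where k: "vabs (\<pi> powi int k) \<le> r"
    using small_uniformiser_pow[OF uniformiser assms] by blast
  have "0 < emeasure H (kball a (vabs (\<pi> powi int k)))"
    using emeasure_kball_pi_pow by blast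
  also have "\<dots> \<le> emeasure H (kball a r)"
    using k by (intro emeasure_mono kball_mono) auto
  finally show ?thesis .
qed

lemma emeasure_compact_finite:
  assumes "compact S"
  shows "emeasure H S < \<infinity>"
proof -
  obtain T where T: "finite T" "S \<subseteq> (\<Union>z\<in>T. ball z 1)"
    using assms unfolding compact_eq_totally_bounded by (meson zero_less_one)
  moreover have "(\<Union>z\<in>T. ball z 1) \<subseteq> (\<Union>z\<in>T. kball z 1)"
    by (intro UN_mono order_refl order_trans[OF ball_subset_cball cball_subset_kball])
  ultimately have "S \<subseteq> (\<Union>z\<in>T. kball z 1)" by blast
  then have "emeasure H S \<le> emeasure H (\<Union>z\<in>T. kball z 1)"
    using T(1) by (intro emeasure_mono) auto
  also have "\<dots> \<le> (\<Sum>z\<in>T. emeasure H (kball z 1))"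
    using T(1) by (intro emeasure_subadditive_finite) auto
  also have "\<dots> < \<infinity>"
    using emeasure_kball_pi_pow[of 0 0]
    by (subst emeasure_kball_centre)
       (simp add: ennreal_mult_less_top ennreal_of_nat_eq_real_of_nat)
  finally show ?thesis .
qed

lemma measure_kball_pi_pow_decay:
  "measure H (kball a (vabs (\<pi> powi (m + int j)))) \<le> measure H (kball 0 (vabs (\<pi> powi m))) / 2 ^ j"
proof (induction j)
  case 0
  then show ?case by (simp add: measure_def emeasure_kball_centre[of a])
next
  case (Suc j)
  let ?h = "\<lambda>a m. measure H (kball a (vabs (\<pi> powi m)))"
  have fin: "emeasure H (kball a (vabs (\<pi> powi m))) = ennreal (?h a m)" for a m
    using emeasure_kball_pi_pow[of a m] by (intro emeasure_eq_ennreal_measure) auto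
  have "ennreal (2 * ?h 0 (m + int j + 1)) \<le> ennreal (?h 0 (m + int j))"
    using twice_emeasure_next_kball[of "m + int j"] unfolding fin by (simp add: ennreal_mult')
  then have "2 * ?h 0 (m + int j + 1) \<le> ?h 0 (m + int j)" by simp
  moreover have "?h a k = ?h 0 k" for k
    by (simp add: measure_def emeasure_kball_centre[of a])
  ultimately have "?h a (m + int j + 1) \<le> ?h a (m + int j) / 2"
    by simp
  also have "\<dots> \<le> ?h 0 m / 2 ^ j / 2"
    using Suc by (intro divide_right_mono) auto
  finally show ?case
    by (simp add: ac_simps)
qed

end

section \<open>Absolute values of analytic functions\<close>

lemma has_sum_terms_bounded:
  fixes f :: "'b \<Rightarrow> 'k::nonarch_local_field"
  assumes "(f has_sum l) UNIV"
  obtains C where "0 \<le> C" "\<And>k. vabs (f k) \<le> C"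
proof -
  have "\<forall>\<^sub>F G in finite_subsets_at_top UNIV. dist (sum f G) l < 1"
    using assms unfolding has_sum_def by (rule tendstoD) simp
  then obtain G0 where G0: "finite G0" "\<And>G. finite G \<Longrightarrow> G0 \<subseteq> G \<Longrightarrow> dist (sum f G) l < 1"
    by (auto simp: eventually_finite_subsets_at_top)
  define C where "C = Max (insert 1 ((\<lambda>k. vabs (f k)) ` G0))"
  have C: "1 \<le> C" "k \<in> G0 \<Longrightarrow> vabs (f k) \<le> C" for k
    using G0(1) by (auto simp: C_def)
  have "vabs (f k) \<le> C" for k
  proof (cases "k \<in> G0")
    case False
    have "f k = (sum f (insert k G0) - l) - (sum f G0 - l)"
      using False G0(1) by simp
    then have "vabs (f k) \<le> max (vabs (sum f (insert k G0) - l)) (vabs (sum f G0 - l))"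
      using vabs_diff_le_max by metis
    also have "\<dots> \<le> 1"
      using G0(2)[of G0] G0(2)[of "insert k G0"] G0(1) subset_insertI[of G0 k]
      by (simp add: dist_vabs)
    finally show ?thesis using C(1) by simp
  qed (rule C(2))
  with C(1) show thesis by (intro that[of C]) auto
qed

text \<open>The ultrametric inequality passes from finite partial sums to the limit.\<close>

lemma vabs_has_sum_minus_term:
  fixes f :: "'b \<Rightarrow> 'k::nonarch_local_field"
  assumes "(f has_sum l) UNIV" "0 \<le> C" "\<And>k. k \<noteq> k0 \<Longrightarrow> vabs (f k) \<le> C"
  shows "vabs (l - f k0) \<le> C"
proof (rule ccontr)
  assume contr: "\<not> vabs (l - f k0) \<le> C"
  then have "0 < vabs (l - f k0)" using assms(2) by linarith
  then have "\<forall>\<^sub>F G in finite_subsets_at_top UNIV. dist (sum f G) l < vabs (l - f k0)"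
    using assms(1) unfolding has_sum_def by (rule tendstoD[rotated])
  then obtain G0 where G0: "finite G0"
      "\<And>G. finite G \<Longrightarrow> G0 \<subseteq> G \<Longrightarrow> dist (sum f G) l < vabs (l - f k0)"
    by (auto simp: eventually_finite_subsets_at_top)
  define G where "G = insert k0 G0"
  have G: "vabs (l - sum f G) < vabs (l - f k0)"
    using G0 by (auto simp: G_def dist_vabs vabs_minus_commute)
  have "sum f G - f k0 = sum f (G - {k0})"
    using G0(1) by (subst sum_diff1) (auto simp: G_def)
  also have "vabs \<dots> \<le> C"
    using assms(2,3) by (intro vabs_sum_le) auto
  finally have "vabs (sum f G - f k0) \<le> C" .
  moreover have "vabs (l - f k0) \<le> max (vabs (l - sum f G)) (vabs (sum f G - f k0))"
    using vabs_add_le_max[of "l - sum f G" "sum f G - f k0"] by simp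
  ultimately show False using G contr by auto
qed

text \<open>The terms of a convergent power series are bounded on the polydisc of convergence; shrinking
  the polydisc by a factor \<open>\<pi>\<^sup>l\<close> multiplies every term but the constant one by at least that factor.\<close>

lemma K_analytic_continuous:
  fixes f :: "('k::nonarch_local_field) ^ 'n::finite \<Rightarrow> 'k"
  assumes "K_analytic_on f S" "a \<in> S" "0 < e" "uniformiser (\<pi> :: 'k)"
  obtains r where "0 < r" "kball a r \<subseteq> S" "\<And>z. z \<in> kball a r \<Longrightarrow> vabs (f z - f a) \<le> e"
proof -
  let ?t = "\<lambda>c z (k :: 'n \<Rightarrow> nat). c k * (\<Prod>i\<in>UNIV. (z $ i - a $ i) ^ k i) :: 'k"
  have "\<exists>r>0. \<exists>c. kball a r \<subseteq> S \<and> (\<forall>z\<in>kball a r. (?t c z has_sum f z) UNIV)"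
    using assms(1,2) unfolding K_analytic_on_def by (rule bspec)
  then obtain r c where r: "0 < r" "kball a r \<subseteq> S"
    and c_all: "\<forall>z\<in>kball a r. (?t c z has_sum f z) UNIV"
    by (elim exE conjE) (rule that)
  note c = bspec[OF c_all]
  obtain j where j: "vabs (\<pi> powi int j) \<le> r"
    using small_uniformiser_pow assms(4) r(1) by blast
  \<comment> \<open>the point of the polydisc at which all monomials have their largest absolute value\<close>
  define z0 :: "'k ^ 'n" where "z0 = (\<chi> i. a $ i + \<pi> ^ j)"
  have z0: "z0 \<in> kball a r"
    using j by (simp add: z0_def kball_iff)
  obtain C where C: "0 \<le> C" "\<And>k. vabs (?t c z0 k) \<le> C"
    by (rule has_sum_terms_bounded[OF c[OF z0]]) (rule that)
  have q: "0 < vabs \<pi>" "vabs \<pi> < 1"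
    using uniformiser_pow[OF assms(4)] by auto
  obtain l where l: "vabs (\<pi> powi int l) \<le> e / (C + 1)"
    using small_uniformiser_pow[OF assms(4), of "e / (C + 1)"] assms(3) C(1) by auto
  have le: "(C + 1) * vabs \<pi> ^ l \<le> e"
    using l C(1) by (simp add: vabs_power field_simps)
  define r' where "r' = vabs \<pi> ^ (j + l)"
  have "r' \<le> vabs (\<pi> powi int j)"
    unfolding r'_def using q by (simp add: vabs_power power_decreasing)
  then have sub: "kball a r' \<subseteq> kball a r"
    using j by (intro kball_mono) simp
  let ?k0 = "\<lambda>_. 0 :: nat"
  have small: "vabs (?t c z k) \<le> e" if z: "z \<in> kball a r'" and k: "k \<noteq> ?k0" for z k
  proof -
    define d where "d = (\<Sum>i\<in>UNIV. k i)"
    obtain i where "k i \<noteq> 0" using k by auto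
    then have "1 \<le> d"
      unfolding d_def using member_le_sum[of i UNIV k] by simp
    have "vabs (?t c z k) = vabs (c k) * (\<Prod>i\<in>UNIV. vabs (z $ i - a $ i) ^ k i)"
      by (simp add: vabs_mult vabs_prod vabs_power)
    also have "\<dots> \<le> vabs (c k) * (\<Prod>i\<in>UNIV. r' ^ k i)"
      using z by (intro mult_left_mono prod_mono conjI power_mono) (auto simp: kball_iff)
    also have "(\<Prod>i\<in>UNIV. r' ^ k i) = (vabs \<pi> ^ j) ^ d * (vabs \<pi> ^ l) ^ d"
      by (simp add: r'_def d_def power_sum power_add power_mult_distrib prod.distrib)
    also have "vabs (c k) * \<dots> = vabs (?t c z0 k) * (vabs \<pi> ^ l) ^ d"
      by (simp add: z0_def vabs_mult vabs_prod vabs_power d_def power_sum)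
    also have "\<dots> \<le> C * (vabs \<pi> ^ l) ^ 1"
      using C \<open>1 \<le> d\<close> q
      by (intro mult_mono power_decreasing power_le_one zero_le_power) auto
    also have "\<dots> \<le> (C + 1) * vabs \<pi> ^ l"
      by (simp add: algebra_simps)
    finally show ?thesis using le by linarith
  qed
  have const: "?t c z ?k0 = c ?k0" for z by simp
  have near: "vabs (f z - c ?k0) \<le> e" if "z \<in> kball a r'" for z
    using vabs_has_sum_minus_term[OF c, of z e ?k0] small[OF that] that sub assms(3)
    unfolding const by auto
  have "a \<in> kball a r'"
    by (simp add: r'_def kball_iff)
  have "vabs (f z - f a) \<le> e" if "z \<in> kball a r'" for z
    using vabs_diff_le_max[of "f z - c ?k0" "f a - c ?k0"] near[OF that] near[OF \<open>a \<in> kball a r'\<close>]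
    by simp
  moreover have "0 < r'" using q by (simp add: r'_def)
  ultimately show thesis
    using that[of r'] sub r(2) by blast
qed

lemma vabs_analytic_locally_constant:
  fixes f :: "('k::nonarch_local_field) ^ 'n::finite \<Rightarrow> 'k"
  assumes "K_analytic_on f S" "a \<in> S" "f a \<noteq> 0" "uniformiser (\<pi> :: 'k)"
  obtains r where "0 < r" "kball a r \<subseteq> S" "\<And>z. z \<in> kball a r \<Longrightarrow> vabs (f z) = vabs (f a)"
proof -
  have pos: "0 < vabs (f a) / 2" using assms(3) by simp
  obtain r where r: "0 < r" "kball a r \<subseteq> S"
      "\<And>z. z \<in> kball a r \<Longrightarrow> vabs (f z - f a) \<le> vabs (f a) / 2"
    using K_analytic_continuous[OF assms(1,2) pos assms(4)] by blast
  have "vabs (f z) = vabs (f a)" if "z \<in> kball a r" for z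
    using r(3)[OF that] pos by (intro vabs_eq_of_near) linarith
  with r show thesis by (intro that[of r])
qed

text \<open>Hence the absolute value of a nowhere vanishing analytic function on a compact set takes finitely
  many values, and it is constant on all balls below some radius.\<close>

lemma vabs_analytic_on_compact:
  fixes f :: "('k::nonarch_local_field) ^ 'n::finite \<Rightarrow> 'k"
  assumes "K_analytic_on f S" "compact S" "\<forall>z\<in>S. f z \<noteq> 0" "uniformiser (\<pi> :: 'k)"
  obtains \<delta> v V where "0 < \<delta>" "0 < v" "\<And>z. z \<in> S \<Longrightarrow> v \<le> vabs (f z)"
    "\<And>z. z \<in> S \<Longrightarrow> vabs (f z) \<le> V"
    "\<And>z z'. z \<in> S \<Longrightarrow> z' \<in> kball z \<delta> \<Longrightarrow> vabs (f z') = vabs (f z)"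
proof -
  have "\<exists>r>0. \<forall>z\<in>kball a r. vabs (f z) = vabs (f a)" if a: "a \<in> S" for a
  proof -
    have "f a \<noteq> 0" using assms(3) a by blast
    then obtain r where "0 < r" "\<And>z. z \<in> kball a r \<Longrightarrow> vabs (f z) = vabs (f a)"
      using vabs_analytic_locally_constant[OF assms(1) a _ assms(4)] by metis
    then show ?thesis by blast
  qed
  then have "\<forall>a\<in>S. \<exists>r. 0 < r \<and> (\<forall>z\<in>kball a r. vabs (f z) = vabs (f a))"
    by blast
  then obtain r where r: "\<And>a. a \<in> S \<Longrightarrow> 0 < r a"
      "\<And>a z. a \<in> S \<Longrightarrow> z \<in> kball a (r a) \<Longrightarrow> vabs (f z) = vabs (f a)"
    by (auto dest!: bchoice)
  have "a \<in> kball a (r a)" if "a \<in> S" for a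
    using r(1)[OF that] by (intro centre_in_kball less_imp_le)
  then have cover: "S \<subseteq> (\<Union>a\<in>S. kball a (r a))"
    by blast
  have "open (kball a (r a))" if "a \<in> S" for a
    using r(1)[OF that] by (rule open_kball)
  then obtain T where T: "T \<subseteq> S" "finite T" "S \<subseteq> (\<Union>a\<in>T. kball a (r a))"
    using compactE_image[OF assms(2) _ cover] by metis
  let ?\<delta> = "Min (insert 1 (r ` T))" and ?v = "Min (insert 1 ((\<lambda>a. vabs (f a)) ` T))"
    and ?V = "Max (insert 1 ((\<lambda>a. vabs (f a)) ` T))"
  show thesis
  proof (rule that)
    show "0 < ?\<delta>" using T r(1) by (subst Min_gr_iff) auto
    show "0 < ?v" using T assms(3) by (subst Min_gr_iff) auto
    fix z assume z: "z \<in> S"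
    then obtain a where a: "a \<in> T" "z \<in> kball a (r a)" using T(3) by blast
    have eq: "vabs (f z) = vabs (f a)" using r(2) a T(1) by blast
    show "?v \<le> vabs (f z)" "vabs (f z) \<le> ?V"
      unfolding eq using a(1) T(2) by (auto intro: Min_le Max_ge)
    fix z' assume "z' \<in> kball z ?\<delta>"
    moreover have "?\<delta> \<le> r a" using a(1) T(2) by (intro Min_le) auto
    ultimately have "z' \<in> kball a (r a)"
      using kball_mono kball_recentre[OF a(2)] by blast
    then show "vabs (f z') = vabs (f z)"
      using r(2) a(1) T(1) eq by auto
  qed
qed

section \<open>The measure of an analytic manifold\<close>

locale analytic_manifold = haar_setting H \<pi>
  for H :: "(('k::nonarch_local_field) ^ 'n::finite) measure" and \<pi> :: 'k +
  fixes A :: "('x::t2_space, 'k, 'n) chart set"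
    and \<omega> :: "('x, 'k, 'n) chart \<Rightarrow> 'k ^ 'n \<Rightarrow> 'k"
    and \<mu> :: "'x measure"
  assumes atlas: "analytic_atlas A"
    and finite_atlas: "finite A"
    and compact_domain: "\<And>a. a \<in> A \<Longrightarrow> compact (fst a)"
    and analytic: "\<And>a. a \<in> A \<Longrightarrow> K_analytic_on (\<omega> a) (snd a ` fst a)"
    and nonvanishing: "nowhere_vanishing A \<omega>"
    and volume: "form_measure A H \<omega> \<mu>"
begin

lemma covering: "\<exists>a\<in>A. x \<in> fst a"
  using atlas unfolding analytic_atlas_def by blast

lemma chart:
  assumes "a \<in> A"
  shows "open (fst a)" "open (snd a ` fst a)"
    and "continuous_on (fst a) (snd a)" "inj_on (snd a) (fst a)"
    and "continuous_on (snd a ` fst a) (inv_into (fst a) (snd a))"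
    and "compact (snd a ` fst a)"
proof -
  have *: "open (fst a) \<and> open (snd a ` fst a) \<and>
      homeomorphism (fst a) (snd a ` fst a) (snd a) (inv_into (fst a) (snd a))"
    using atlas assms unfolding analytic_atlas_def case_prod_beta by blast
  then show "open (fst a)" "open (snd a ` fst a)"
    and cont: "continuous_on (fst a) (snd a)"
    and "continuous_on (snd a ` fst a) (inv_into (fst a) (snd a))"
    by (auto simp: homeomorphism_def)
  show "inj_on (snd a) (fst a)"
    using * unfolding homeomorphism_def by (metis inj_on_inverseI)
  show "compact (snd a ` fst a)"
    using compact_continuous_image[OF cont compact_domain[OF assms]] .
qed

lemma sets_mu [measurable_cong, simp]: "sets \<mu> = sets borel"
  using volume by (simp add: form_measure_def)

lemma space_mu [simp]: "space \<mu> = UNIV"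
  using sets_eq_imp_space_eq[OF sets_mu] by simp

lemma chart_image_borel:
  assumes "a \<in> A" "S \<in> sets borel" "S \<subseteq> fst a"
  shows "snd a ` S \<in> sets borel"
proof -
  let ?V = "snd a ` fst a" and ?g = "inv_into (fst a) (snd a)"
  have V: "?V \<in> sets borel"
    using chart(2)[OF assms(1)] by simp
  have "?g \<in> borel_measurable (restrict_space borel ?V)"
    using chart(5)[OF assms(1)] by (rule borel_measurable_continuous_on_restrict)
  then have "?g -` S \<inter> ?V \<in> sets (restrict_space borel ?V)"
    using assms(2) by (auto dest: measurable_sets simp: space_restrict_space)
  then have "?g -` S \<inter> ?V \<in> sets borel"
    using V by (simp add: sets_restrict_space_iff)
  moreover have "?g -` S \<inter> ?V = snd a ` S"
    using assms(3) chart(4)[OF assms(1)] by (force simp: inv_into_f_f)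
  ultimately show ?thesis by simp
qed

lemma emeasure_in_chart:
  assumes "a \<in> A" "S \<in> sets borel" "S \<subseteq> fst a"
  shows "emeasure \<mu> S = (\<integral>\<^sup>+z. ennreal (vabs (\<omega> a z)) * indicator (snd a ` S) z \<partial>H)"
  using volume assms by (auto simp: form_measure_def)

lemma emeasure_le_density:
  assumes "a \<in> A" "S \<in> sets borel" "S \<subseteq> fst a" "\<And>z. z \<in> snd a ` S \<Longrightarrow> vabs (\<omega> a z) \<le> V"
  shows "emeasure \<mu> S \<le> ennreal V * emeasure H (snd a ` S)"
proof -
  have "emeasure \<mu> S \<le> (\<integral>\<^sup>+z. ennreal V * indicator (snd a ` S) z \<partial>H)"
    unfolding emeasure_in_chart[OF assms(1-3)] using assms(4)
    by (intro nn_integral_mono) (auto simp: indicator_def intro: ennreal_leI)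
  also have "\<dots> = ennreal V * emeasure H (snd a ` S)"
    using chart_image_borel[OF assms(1-3)] by (intro nn_integral_cmult_indicator) simp
  finally show ?thesis .
qed

lemma emeasure_ge_density:
  assumes "a \<in> A" "S \<in> sets borel" "S \<subseteq> fst a" "\<And>z. z \<in> snd a ` S \<Longrightarrow> v \<le> vabs (\<omega> a z)"
  shows "ennreal v * emeasure H (snd a ` S) \<le> emeasure \<mu> S"
proof -
  have "ennreal v * emeasure H (snd a ` S) = (\<integral>\<^sup>+z. ennreal v * indicator (snd a ` S) z \<partial>H)"
    using chart_image_borel[OF assms(1-3)] by (intro nn_integral_cmult_indicator[symmetric]) simp
  also have "\<dots> \<le> emeasure \<mu> S"
    unfolding emeasure_in_chart[OF assms(1-3)] using assms(4)
    by (intro nn_integral_mono) (auto simp: indicator_def intro: ennreal_leI)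
  finally show ?thesis .
qed

lemma density_bounds:
  assumes "a \<in> A"
  obtains \<delta> v V where "0 < \<delta>" "0 < v" "\<And>z. z \<in> snd a ` fst a \<Longrightarrow> v \<le> vabs (\<omega> a z)"
    "\<And>z. z \<in> snd a ` fst a \<Longrightarrow> vabs (\<omega> a z) \<le> V"
    "\<And>z z'. z \<in> snd a ` fst a \<Longrightarrow> z' \<in> kball z \<delta> \<Longrightarrow> vabs (\<omega> a z') = vabs (\<omega> a z)"
proof -
  have nz: "\<forall>z\<in>snd a ` fst a. \<omega> a z \<noteq> 0"
    using nonvanishing assms unfolding nowhere_vanishing_def by blast
  show thesis
    by (rule vabs_analytic_on_compact[OF analytic[OF assms] chart(6)[OF assms] nz uniformiser])
       (rule that)
qed

lemma finite_measure_mu: "finite_measure \<mu>"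
proof (rule finite_measureI)
  have "emeasure \<mu> (fst a) < \<infinity>" if a: "a \<in> A" for a
  proof -
    have borel: "fst a \<in> sets borel" using chart(1)[OF a] by simp
    obtain V where V: "\<And>z. z \<in> snd a ` fst a \<Longrightarrow> vabs (\<omega> a z) \<le> V"
      by (rule density_bounds[OF a]) (rule that)
    have "emeasure \<mu> (fst a) \<le> ennreal V * emeasure H (snd a ` fst a)"
      by (rule emeasure_le_density[OF a borel order_refl V])
    also have "\<dots> < \<infinity>"
      using emeasure_compact_finite[OF chart(6)[OF a]] by (simp add: ennreal_mult_less_top)
    finally show ?thesis .
  qed
  then have sum_fin: "(\<Sum>a\<in>A. emeasure \<mu> (fst a)) \<noteq> \<infinity>"
    using finite_atlas by (auto simp: less_top)
  have cover: "space \<mu> = (\<Union>a\<in>A. fst a)"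
    using covering by auto
  have "emeasure \<mu> (space \<mu>) \<le> (\<Sum>a\<in>A. emeasure \<mu> (fst a))"
    unfolding cover using finite_atlas chart(1) by (intro emeasure_subadditive_finite) auto
  with sum_fin show "emeasure \<mu> (space \<mu>) \<noteq> \<infinity>"
    by (auto simp: top_unique)
qed

sublocale finite_measure \<mu> by (rule finite_measure_mu)

lemma ball_preimage:
  assumes "a \<in> A" "B \<subseteq> fst a" "snd a ` B = kball b r"
  shows "B = fst a \<inter> snd a -` kball b r"
  using assms(2) inj_on_image_mem_iff[OF chart(4)[OF assms(1)] _ assms(2)]
  unfolding assms(3)[symmetric] by blast

lemma closed_chart_preimage_kball:
  assumes "a \<in> A"
  shows "closed (fst a \<inter> snd a -` kball b r)"
  using chart(3) compact_domain[OF assms] assms closed_kball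
  by (intro continuous_closed_preimage) (auto intro: compact_imp_closed)

lemma open_chart_preimage_kball:
  assumes "a \<in> A" "0 < r"
  shows "open (fst a \<inter> snd a -` kball b r)"
  using chart(1,3)[OF assms(1)] open_kball[OF assms(2)] by (intro continuous_open_preimage) auto

text \<open>In a chart the density is bounded below, and an open set contains a coordinate ball.\<close>

lemma measure_open_pos:
  assumes "open S" "x \<in> S"
  shows "0 < measure \<mu> S"
proof -
  obtain a where a: "a \<in> A" "x \<in> fst a" using covering by blast
  obtain \<delta> v V where d: "0 < v" "\<And>z. z \<in> snd a ` fst a \<Longrightarrow> v \<le> vabs (\<omega> a z)"
    by (rule density_bounds[OF a(1)]) (rule that)
  let ?S = "S \<inter> fst a"
  have S: "open ?S" using assms(1) chart(1)[OF a(1)] by blast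
  have "snd a ` ?S = snd a ` fst a \<inter> inv_into (fst a) (snd a) -` S"
    using chart(4)[OF a(1)] by (force simp: inv_into_f_f)
  then have "open (snd a ` ?S)"
    using continuous_open_preimage[OF chart(5,2)[OF a(1)] assms(1)] by simp
  moreover have "snd a x \<in> snd a ` ?S" using a assms(2) by blast
  ultimately obtain r where r: "0 < r" "kball (snd a x) r \<subseteq> snd a ` ?S"
    by (rule open_contains_kball)
  have "0 < ennreal v * emeasure H (kball (snd a x) r)"
    using d(1) emeasure_kball_pos[OF r(1)] by (simp add: ennreal_zero_less_mult_iff)
  also have "\<dots> \<le> ennreal v * emeasure H (snd a ` ?S)"
    using r(2) chart_image_borel[OF a(1), of ?S] S by (intro mult_left_mono emeasure_mono) auto
  also have "\<dots> \<le> emeasure \<mu> ?S"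
    using S d(2) by (intro emeasure_ge_density[OF a(1)]) auto
  also have "\<dots> \<le> emeasure \<mu> S"
    using assms(1) by (intro emeasure_mono) auto
  finally show ?thesis
    by (simp add: emeasure_eq_measure)
qed

section \<open>Joins and the geodetic distance inside a ball\<close>

lemma is_ball_closed:
  assumes "is_ball A r B"
  shows "closed B"
proof -
  obtain a b where a: "a \<in> A" "B \<subseteq> fst a" "snd a ` B = kball b r"
    using assms unfolding is_ball_def by blast
  show ?thesis
    using ball_preimage[OF a] closed_chart_preimage_kball[OF a(1)] by metis
qed

lemma join_borel: "join_set A x y \<in> sets borel"
proof -
  have "closed (join_set A x y)"
    unfolding join_set_def using is_ball_closed by (intro closed_Inter) auto
  then show ?thesis by simp
qed

lemma measure_join_le:
  assumes "is_ball A r B" "x \<in> B" "y \<in> B"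
  shows "measure \<mu> (join_set A x y) \<le> measure \<mu> B"
  using is_ball_closed[OF assms(1)] join_borel assms
  by (intro finite_measure_mono) (auto simp: join_set_def)

text \<open>In a chart, a ball containing two points contains the smallest coordinate ball around the
  first that reaches the second. As there are finitely many charts, the join of distinct points
  contains a neighbourhood and therefore is not a null set.\<close>

lemma measure_join_pos:
  assumes "x \<noteq> y"
  shows "0 < measure \<mu> (join_set A x y)"
proof -
  define A' where "A' = {a\<in>A. x \<in> fst a \<and> y \<in> fst a}"
  define N where "N a = fst a \<inter> snd a -` kball (snd a x) (maxnorm (snd a y - snd a x))"
    for a :: "('x, 'k, 'n) chart"
  have pos: "0 < maxnorm (snd a y - snd a x)" if a: "a \<in> A'" for a
  proof (rule ccontr)
    assume "\<not> ?thesis"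
    then have "maxnorm (snd a y - snd a x) \<le> 0" by linarith
    then have "vabs ((snd a y - snd a x) $ i) \<le> 0" for i
      by (simp only: maxnorm_le_iff)
    then have "vabs ((snd a y - snd a x) $ i) = 0" for i
      by (intro antisym vabs_nonneg)
    then have "(snd a y - snd a x) $ i = 0" for i
      by (simp only: vabs_eq_0_iff)
    then have "snd a x = snd a y" by (simp add: vec_eq_iff)
    with assms a show False
      using chart(4)[of a] by (auto simp: A'_def inj_on_def)
  qed
  have "open (\<Inter>a\<in>A'. N a)"
    unfolding N_def using finite_atlas pos
    by (intro open_INT ballI open_chart_preimage_kball) (auto simp: A'_def)
  moreover have "x \<in> (\<Inter>a\<in>A'. N a)"
    using pos by (auto simp: N_def A'_def intro!: centre_in_kball intro: less_imp_le)
  ultimately have "0 < measure \<mu> (\<Inter>a\<in>A'. N a)"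
    by (rule measure_open_pos)
  also have "\<dots> \<le> measure \<mu> (join_set A x y)"
  proof (rule finite_measure_mono)
    show "join_set A x y \<in> sets \<mu>" using join_borel by simp
    show "(\<Inter>a\<in>A'. N a) \<subseteq> join_set A x y"
      unfolding join_set_def
    proof (rule Inter_greatest)
      fix B assume "B \<in> {B. (\<exists>r. is_ball A r B) \<and> x \<in> B \<and> y \<in> B}"
      then obtain r a b where B: "x \<in> B" "y \<in> B" "a \<in> A" "B \<subseteq> fst a" "snd a ` B = kball b r"
        unfolding is_ball_def by blast
      have x: "snd a x \<in> kball b r" and y: "snd a y \<in> kball b r"
        using B by auto
      have "maxnorm (snd a y - snd a x) \<le> r"
        using y unfolding kball_recentre[OF x, symmetric] by (simp add: kball_def)
      then have "N a \<subseteq> B"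
        using ball_preimage[OF B(3-5)] kball_recentre[OF x] kball_mono unfolding N_def by blast
      moreover have "a \<in> A'" using B by (auto simp: A'_def)
      ultimately show "(\<Inter>a\<in>A'. N a) \<subseteq> B" by blast
    qed
  qed
  finally show ?thesis .
qed

lemma geodetic_dist_in_ball:
  assumes "is_ball A r B" "x \<in> B" "y \<in> B" "x \<noteq> y"
  shows "0 < geodetic_dist A \<mu> x y" "geodetic_dist A \<mu> x y \<le> measure \<mu> B"
proof -
  have "geodetic_dist A \<mu> x y = measure \<mu> (join_set A x y)"
    using assms by (auto simp: geodetic_dist_def)
  then show "0 < geodetic_dist A \<mu> x y" "geodetic_dist A \<mu> x y \<le> measure \<mu> B"
    using measure_join_pos[OF assms(4)] measure_join_le[OF assms(1-3)] by simp_all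
qed

end

section \<open>Wavelets in a chart\<close>

definition nonzero_set :: "('x \<Rightarrow> complex) \<Rightarrow> 'x set" where
  "nonzero_set \<psi> = {x. \<psi> x \<noteq> 0}"

locale wavelet_system = analytic_manifold H \<pi> A \<omega> \<mu>
  for H :: "(('k::nonarch_local_field) ^ 'n::finite) measure" and \<pi> :: 'k
    and A :: "('x::t2_space, 'k, 'n) chart set" and \<omega> and \<mu> :: "'x measure" +
  fixes chi :: "'k \<Rightarrow> complex" and W :: "('x \<Rightarrow> complex) set"
  assumes character: "additive_character chi"
    and chi_integers: "u \<in> int_ring \<Longrightarrow> chi u = 1"
    and chi_nontrivial: "\<exists>u\<in>int_ring. chi (u / \<pi>) \<noteq> 1"
    and W_wavelets: "W \<subseteq> wavelets A \<pi> chi \<mu>"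
    and W_orthonormal: "L2_orthonormal \<mu> W"
begin

lemma chi_add: "chi (x + y) = chi x * chi y" and norm_chi [simp]: "norm (chi x) = 1"
  using character by (auto simp: additive_character_def)

lemma chi_nonzero [simp]: "chi x \<noteq> 0"
  using norm_chi[of x] by (metis norm_zero zero_neq_one)

definition phase :: "int \<Rightarrow> 'k ^ 'n \<Rightarrow> 'k ^ 'n \<Rightarrow> complex" where
  "phase m \<eta> z = chi (\<pi> powi (- m - 1) * (\<Sum>i\<in>UNIV. \<eta> $ i * z $ i))"

lemma phase_nonzero [simp]: "phase m \<eta> z \<noteq> 0" and norm_phase [simp]: "norm (phase m \<eta> z) = 1"
  by (simp_all add: phase_def)

lemma phase_add: "phase m \<eta> (z + z') = phase m \<eta> z * phase m \<eta> z'"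
  by (simp add: phase_def algebra_simps sum.distrib flip: chi_add)

lemma phase_add_frequency: "phase m (\<eta> + \<eta>') z = phase m \<eta> z * phase m \<eta>' z"
  by (simp add: phase_def algebra_simps sum.distrib flip: chi_add)

lemma int_ring_mult: "u \<in> int_ring \<Longrightarrow> v \<in> int_ring \<Longrightarrow> u * v \<in> (int_ring :: 'k set)"
  by (simp add: int_ring_def vabs_mult mult_le_one)

lemma int_ring_sum: "(\<And>i. i \<in> I \<Longrightarrow> f i \<in> int_ring) \<Longrightarrow> sum f I \<in> (int_ring :: 'k set)"
  unfolding int_ring_def using vabs_sum_le[of I f 1] by simp

text \<open>Frequencies only matter modulo \<open>\<pi>\<close>.\<close>

lemma phase_trivial:
  assumes "\<And>i. vabs (\<eta> $ i) \<le> vabs \<pi>" "z \<in> kball 0 (vabs (\<pi> powi m))"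
  shows "phase m \<eta> z = 1"
proof -
  have "\<pi> powi (- m - 1) * (\<Sum>i\<in>UNIV. \<eta> $ i * z $ i)
      = (\<Sum>i\<in>UNIV. (\<eta> $ i / \<pi>) * (z $ i / \<pi> powi m))"
    using pi_pow(1) by (simp add: sum_distrib_left power_int_diff power_int_minus field_simps)
  also have "\<dots> \<in> int_ring"
  proof (intro int_ring_sum int_ring_mult)
    show "\<eta> $ i / \<pi> \<in> int_ring" for i
      using assms(1)[of i] pi_pow(2) by (simp add: int_ring_def vabs_divide)
    show "z $ i / \<pi> powi m \<in> int_ring" for i
      using assms(2) pi_pow(4)[of m] by (simp add: int_ring_def vabs_divide kball_iff)
  qed
  finally show ?thesis
    unfolding phase_def by (rule chi_integers)
qed

text \<open>A frequency that is nonzero modulo \<open>\<pi>\<close> gives a phase that varies on the ball.\<close>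

lemma phase_nontrivial:
  assumes "\<forall>i. \<eta> $ i \<in> int_ring" "\<exists>i. \<eta> $ i \<notin> (\<lambda>u. \<pi> * u) ` int_ring"
  obtains h where "h \<in> kball 0 (vabs (\<pi> powi m))" "phase m \<eta> h \<noteq> 1"
proof -
  obtain i where i: "\<eta> $ i \<notin> (\<lambda>u. \<pi> * u) ` int_ring" using assms(2) by blast
  have unit: "vabs (\<eta> $ i) = 1"
  proof (rule ccontr)
    assume "vabs (\<eta> $ i) \<noteq> 1"
    then have "vabs (\<eta> $ i) < 1"
      using assms(1) by (simp add: int_ring_def less_le)
    then have "vabs (\<eta> $ i) \<le> vabs \<pi>"
      using uniformiser by (simp add: uniformiser_def)
    then have "\<eta> $ i / \<pi> \<in> int_ring"
      using pi_pow(2) by (simp add: int_ring_def vabs_divide)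
    moreover have "\<eta> $ i = \<pi> * (\<eta> $ i / \<pi>)"
      using pi_pow(1) by simp
    ultimately show False using i by blast
  qed
  then have nz: "\<eta> $ i \<noteq> 0" by auto
  obtain u where u: "u \<in> int_ring" "chi (u / \<pi>) \<noteq> 1"
    using chi_nontrivial by blast
  define h :: "'k ^ 'n" where "h = axis i (\<pi> powi m * u / \<eta> $ i)"
  have "(\<Sum>j\<in>UNIV. \<eta> $ j * h $ j) = (\<Sum>j\<in>UNIV. if j = i then \<pi> powi m * u else 0)"
    using nz by (intro sum.cong) (auto simp: h_def axis_def)
  then have "(\<Sum>j\<in>UNIV. \<eta> $ j * h $ j) = \<pi> powi m * u" by simp
  then have "phase m \<eta> h = chi (u / \<pi>)"
    using pi_pow(1) by (simp add: phase_def power_int_diff power_int_minus field_simps)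
  moreover have "h \<in> kball 0 (vabs (\<pi> powi m))"
    using u(1) pi_pow(4)[of m] unit
    by (auto simp: kball_iff h_def axis_def vabs_mult vabs_divide int_ring_def mult_left_le)
  ultimately show thesis using u(2) that by metis
qed

text \<open>What a single chart sees of a wavelet on a ball of radius \<open>|\<pi>|\<^sup>m\<close>: the shape of the support and
  a frequency that is nonzero modulo \<open>\<pi>\<close>. The triple of chart, level \<open>m\<close> and residue class of the
  frequency is the key by which wavelets are grouped when they are counted.\<close>

definition chart_wavelet ::
    "('x, 'k, 'n) chart \<Rightarrow> int \<Rightarrow> 'k ^ 'n \<Rightarrow> ('x \<Rightarrow> complex) \<Rightarrow> bool" where
  "chart_wavelet a m \<eta> \<psi> \<longleftrightarrow> a \<in> A \<and> nonzero_set \<psi> \<subseteq> fst a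
     \<and> (\<exists>b. snd a ` nonzero_set \<psi> = kball b (vabs (\<pi> powi m)))
     \<and> (\<exists>c. \<forall>x\<in>nonzero_set \<psi>. \<psi> x = c * phase m \<eta> (snd a x))
     \<and> (\<forall>i. \<eta> $ i \<in> int_ring) \<and> (\<exists>i. \<eta> $ i \<notin> (\<lambda>u. \<pi> * u) ` int_ring)"

text \<open>A Kozyrev wavelet has constant absolute value on its support, and the normalisation in \<open>L\<^sup>2\<close>
  turns this constant into the volume of the support.\<close>

lemma wavelet_cases:
  assumes "\<psi> \<in> W"
  obtains a m \<eta> r where "chart_wavelet a m \<eta> \<psi>" "is_ball A r (nonzero_set \<psi>)"
    "0 < measure \<mu> (nonzero_set \<psi>)"
    "\<And>x. x \<in> nonzero_set \<psi> \<Longrightarrow> (norm (\<psi> x))\<^sup>2 = 1 / measure \<mu> (nonzero_set \<psi>)"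
proof -
  obtain B where B: "wavelet_on A \<pi> chi \<mu> B \<psi>"
    using assms W_wavelets by (auto simp: wavelets_def)
  then obtain r where r: "is_ball A r B" by (auto simp: wavelet_on_def)
  then obtain a where a: "a \<in> A" "B \<subseteq> fst a" by (auto simp: is_ball_def)
  have outside: "\<psi> x = 0" if "x \<notin> B" for x
    using B that by (auto simp: wavelet_on_def)
  have unit: "(LINT x|\<mu>. complex_of_real ((norm (\<psi> x))\<^sup>2)) = 1"
    using B by (auto simp: wavelet_on_def)
  obtain x0 m g where g: "kozyrev_wavelet \<pi> chi (snd a x0) m g"
      "snd a ` B = kball (snd a x0) (vabs (\<pi> powi m))"
      "\<forall>z\<in>snd a ` fst a. (\<psi> \<circ> inv_into (fst a) (snd a)) z = g z"
    using B a unfolding wavelet_on_def by blast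
  obtain c \<eta> where \<eta>: "\<forall>i. \<eta> $ i \<in> int_ring" "\<exists>i. \<eta> $ i \<notin> (\<lambda>u. \<pi> * u) ` int_ring"
    and g_eq: "g = (\<lambda>z. c * chi (\<pi> powi (- m - 1) * (\<Sum>i\<in>UNIV. \<eta> $ i * z $ i))
                     * indicator (kball (snd a x0) (vabs (\<pi> powi m))) z)"
    using g(1) unfolding kozyrev_wavelet_def by blast
  have inside: "\<psi> x = c * phase m \<eta> (snd a x)" if x: "x \<in> B" for x
  proof -
    have "x \<in> fst a" using x a(2) by blast
    then have "\<psi> x = g (snd a x)"
      using g(3) chart(4)[OF a(1)] by (metis comp_apply imageI inv_into_f_f)
    moreover have "snd a x \<in> kball (snd a x0) (vabs (\<pi> powi m))"
      using x g(2) by blast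
    ultimately show ?thesis by (simp add: g_eq phase_def)
  qed
  have eq: "(norm (\<psi> x))\<^sup>2 = (norm c)\<^sup>2 * indicator B x" for x
    using inside outside by (cases "x \<in> B") (simp_all add: norm_mult)
  have "B \<in> sets \<mu>"
    using is_ball_closed[OF r] by simp
  then have "(LINT x|\<mu>. (norm (\<psi> x))\<^sup>2) = (norm c)\<^sup>2 * measure \<mu> B"
    unfolding eq by simp
  moreover have "complex_of_real (LINT x|\<mu>. (norm (\<psi> x))\<^sup>2) = 1"
    using unit by (simp only: integral_complex_of_real)
  ultimately have one: "(norm c)\<^sup>2 * measure \<mu> B = 1"
    by (simp only: of_real_eq_1_iff)
  then have c: "c \<noteq> 0" and pos: "0 < measure \<mu> B"
    by (auto simp: less_le)
  have supp: "nonzero_set \<psi> = B"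
    using inside outside c unfolding nonzero_set_def by force
  show thesis
  proof (rule that)
    show "chart_wavelet a m \<eta> \<psi>"
      unfolding chart_wavelet_def supp using a g(2) inside \<eta> by blast
    show "is_ball A r (nonzero_set \<psi>)" "0 < measure \<mu> (nonzero_set \<psi>)"
      unfolding supp by (fact r pos)+
    show "(norm (\<psi> x))\<^sup>2 = 1 / measure \<mu> (nonzero_set \<psi>)" if "x \<in> nonzero_set \<psi>" for x
      using that one pos unfolding supp eq by (simp add: field_simps)
  qed
qed

lemma chart_wavelet_borel: "chart_wavelet a m \<eta> \<psi> \<Longrightarrow> nonzero_set \<psi> \<in> sets borel"
  unfolding chart_wavelet_def
  using ball_preimage closed_chart_preimage_kball by (metis borel_closed)

text \<open>Two wavelets on the same ball whose frequencies agree modulo \<open>\<pi>\<close> are proportional, and an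
  orthonormal family contains no two proportional functions. Hence a family with a fixed chart,
  level and frequency class has pairwise disjoint supports.\<close>

lemma same_class_overlapping_imp_eq:
  assumes W: "\<psi> \<in> W" "\<psi>' \<in> W"
    and cw: "chart_wavelet a m \<eta> \<psi>" "chart_wavelet a m \<eta>' \<psi>'"
    and residue: "\<eta> \<in> kball w (vabs \<pi>)" "\<eta>' \<in> kball w (vabs \<pi>)"
    and meet: "nonzero_set \<psi> \<inter> nonzero_set \<psi>' \<noteq> {}"
  shows "\<psi> = \<psi>'"
proof -
  let ?r = "vabs (\<pi> powi m)"
  obtain b c where b: "nonzero_set \<psi> \<subseteq> fst a" "snd a ` nonzero_set \<psi> = kball b ?r"
      and c: "\<And>x. x \<in> nonzero_set \<psi> \<Longrightarrow> \<psi> x = c * phase m \<eta> (snd a x)"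
    using cw(1) unfolding chart_wavelet_def by blast
  obtain b' c' where b': "nonzero_set \<psi>' \<subseteq> fst a" "snd a ` nonzero_set \<psi>' = kball b' ?r"
      and c': "\<And>x. x \<in> nonzero_set \<psi>' \<Longrightarrow> \<psi>' x = c' * phase m \<eta>' (snd a x)"
    using cw(2) unfolding chart_wavelet_def by blast
  have a: "a \<in> A" using cw(1) by (simp add: chart_wavelet_def)
  have "kball b ?r \<inter> kball b' ?r \<noteq> {}"
    using meet b(2) b'(2) by blast
  then have "kball b ?r = kball b' ?r" by (rule kball_meet_imp_eq)
  then have same: "nonzero_set \<psi>' = nonzero_set \<psi>"
    using ball_preimage[OF a b] ball_preimage[OF a b'] by simp
  obtain x0 where x0: "x0 \<in> nonzero_set \<psi>" using meet by blast
  have "\<eta>' \<in> kball \<eta> (vabs \<pi>)"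
    using residue kball_recentre by blast
  then have diff: "\<And>i. vabs ((\<eta>' - \<eta>) $ i) \<le> vabs \<pi>"
    by (simp add: kball_iff)
  define k where "k = c' / c * phase m (\<eta>' - \<eta>) (snd a x0)"
  have "\<psi>' x = k * \<psi> x" for x
  proof (cases "x \<in> nonzero_set \<psi>")
    case True
    have "snd a x \<in> kball b ?r" "snd a x0 \<in> kball b ?r"
      using True x0 b(2) by blast+
    then have "snd a x \<in> kball (snd a x0) ?r"
      using kball_recentre by blast
    then have "snd a x - snd a x0 \<in> kball 0 ?r"
      by (simp add: kball_iff)
    then have "phase m (\<eta>' - \<eta>) (snd a x - snd a x0) = 1"
      by (rule phase_trivial[OF diff])
    then have "phase m (\<eta>' - \<eta>) (snd a x) = phase m (\<eta>' - \<eta>) (snd a x0)"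
      using phase_add[of m "\<eta>' - \<eta>" "snd a x - snd a x0" "snd a x0"] by simp
    then have "phase m \<eta>' (snd a x) = phase m \<eta> (snd a x) * phase m (\<eta>' - \<eta>) (snd a x0)"
      using phase_add_frequency[of m \<eta> "\<eta>' - \<eta>" "snd a x"] by simp
    moreover have "c \<noteq> 0"
      using c[OF x0] x0 by (auto simp: nonzero_set_def)
    ultimately show ?thesis
      using True c[of x] c'[of x] by (simp add: same k_def)
  next
    case False
    then show ?thesis using same by (auto simp: nonzero_set_def)
  qed
  then have proportional: "\<psi>' = (\<lambda>x. k * \<psi> x)" by blast
  have "k \<noteq> 0"
    using x0 same by (auto simp: proportional nonzero_set_def)
  have "(LINT x|\<mu>. \<psi> x * cnj (\<psi> x)) = 1"
    using W W_orthonormal by (simp add: L2_orthonormal_def)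
  then have "(LINT x|\<mu>. \<psi>' x * cnj (\<psi> x)) = k"
    by (simp add: proportional mult.assoc)
  moreover have "(LINT x|\<mu>. \<psi>' x * cnj (\<psi> x)) = (if \<psi>' = \<psi> then 1 else 0)"
    using W W_orthonormal unfolding L2_orthonormal_def by blast
  ultimately show ?thesis
    using \<open>k \<noteq> 0\<close> by (auto split: if_splits)
qed

section \<open>Summing over the wavelets\<close>

text \<open>At a fixed level the wavelets fall into finitely many frequency classes, and the supports within
  a class are disjoint. The bound is the number of classes times the volume of the manifold.\<close>

lemma level_sum_bound:
  obtains N :: real where "0 \<le> N"
    "\<And>a m F. finite F \<Longrightarrow> F \<subseteq> W \<Longrightarrow> \<forall>\<psi>\<in>F. \<exists>\<eta>. chart_wavelet a m \<eta> \<psi>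
        \<Longrightarrow> (\<Sum>\<psi>\<in>F. measure \<mu> (nonzero_set \<psi>)) \<le> N"
proof -
  obtain R :: "('k ^ 'n) set" where R: "finite R"
    "\<And>z. (\<And>i. z $ i \<in> int_ring) \<Longrightarrow> \<exists>w\<in>R. z \<in> kball w (vabs \<pi>)"
    using finite_residue_representatives[OF uniformiser] by blast
  have "(\<Sum>\<psi>\<in>F. measure \<mu> (nonzero_set \<psi>)) \<le> card R * measure \<mu> UNIV"
    if F: "finite F" "F \<subseteq> W" "\<forall>\<psi>\<in>F. \<exists>\<eta>. chart_wavelet a m \<eta> \<psi>" for a m F
  proof -
    obtain \<eta> where \<eta>: "\<And>\<psi>. \<psi> \<in> F \<Longrightarrow> chart_wavelet a m (\<eta> \<psi>) \<psi>"
      using bchoice[OF F(3)] by blast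
    have "\<exists>w. w \<in> R \<and> \<eta> \<psi> \<in> kball w (vabs \<pi>)" if "\<psi> \<in> F" for \<psi>
      using R(2)[of "\<eta> \<psi>"] \<eta>[OF that] unfolding chart_wavelet_def by blast
    then have "\<forall>\<psi>\<in>F. \<exists>w. w \<in> R \<and> \<eta> \<psi> \<in> kball w (vabs \<pi>)"
      by blast
    from bchoice[OF this] obtain cls where cls: "\<And>\<psi>. \<psi> \<in> F \<Longrightarrow> cls \<psi> \<in> R"
        "\<And>\<psi>. \<psi> \<in> F \<Longrightarrow> \<eta> \<psi> \<in> kball (cls \<psi>) (vabs \<pi>)"
      by blast
    have "(\<Sum>\<psi> | \<psi> \<in> F \<and> cls \<psi> = w. measure \<mu> (nonzero_set \<psi>)) \<le> measure \<mu> UNIV" for w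
    proof -
      let ?F = "{\<psi> \<in> F. cls \<psi> = w}"
      have "disjoint_family_on nonzero_set ?F"
        unfolding disjoint_family_on_def
      proof (intro ballI impI, rule ccontr)
        fix \<psi> \<psi>' assume *: "\<psi> \<in> ?F" "\<psi>' \<in> ?F" "\<psi> \<noteq> \<psi>'"
          and meet: "nonzero_set \<psi> \<inter> nonzero_set \<psi>' \<noteq> {}"
        have F': "\<psi> \<in> F" "\<psi>' \<in> F" "cls \<psi> = w" "cls \<psi>' = w" using * by auto
        have "\<psi> = \<psi>'"
          using same_class_overlapping_imp_eq[OF _ _ \<eta>[OF F'(1)] \<eta>[OF F'(2)] _ _ meet]
            cls(2)[OF F'(1)] cls(2)[OF F'(2)] F' F(2) by auto
        with * show False by blast
      qed
      then have "(\<Sum>\<psi>\<in>?F. measure \<mu> (nonzero_set \<psi>)) = measure \<mu> (\<Union>\<psi>\<in>?F. nonzero_set \<psi>)"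
        using F(1) chart_wavelet_borel[OF \<eta>]
        by (intro finite_measure_finite_Union[symmetric]) auto
      also have "\<dots> \<le> measure \<mu> UNIV"
        using bounded_measure by simp
      finally show ?thesis .
    qed
    then have "(\<Sum>w\<in>R. \<Sum>\<psi> | \<psi> \<in> F \<and> cls \<psi> = w. measure \<mu> (nonzero_set \<psi>))
        \<le> (\<Sum>w\<in>R. measure \<mu> UNIV)"
      by (intro sum_mono)
    moreover have "(\<Sum>w\<in>R. \<Sum>\<psi> | \<psi> \<in> F \<and> cls \<psi> = w. measure \<mu> (nonzero_set \<psi>))
        = (\<Sum>\<psi>\<in>F. measure \<mu> (nonzero_set \<psi>))"
      using F(1) R(1) cls(1) by (intro sum.group) auto
    ultimately show ?thesis by simp
  qed
  then show thesis
    by (intro that[of "card R * measure \<mu> UNIV"]) auto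
qed

text \<open>The image of the compact chart domain is bounded, which limits the radii from above and gives a
  first level \<open>m0\<close>; from there on volumes shrink like those of coordinate balls.\<close>

lemma chart_wavelet_measure_decay:
  assumes a: "a \<in> A"
  obtains C m0 where "\<And>m \<eta> \<psi>. chart_wavelet a m \<eta> \<psi>
      \<Longrightarrow> \<exists>j. m = m0 + int j \<and> measure \<mu> (nonzero_set \<psi>) \<le> C / 2 ^ j"
proof -
  obtain V where V: "\<And>z. z \<in> snd a ` fst a \<Longrightarrow> vabs (\<omega> a z) \<le> V"
    by (rule density_bounds[OF a]) (rule that)
  have "bounded (snd a ` fst a)"
    using chart(6)[OF a] by (rule compact_imp_bounded)
  then obtain z0 e where e: "\<And>z. z \<in> snd a ` fst a \<Longrightarrow> dist z0 z \<le> e"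
    unfolding bounded_def by blast
  \<comment> \<open>no two points of the image have distance above \<open>2 * e\<close>\<close>
  obtain m0 where m0: "2 * e < vabs (\<pi> powi m0)"
    by (rule large_uniformiser_pow[OF uniformiser])
  define C where "C = max V 0 * measure H (kball 0 (vabs (\<pi> powi m0)))"
  have "\<exists>j. m = m0 + int j \<and> measure \<mu> (nonzero_set \<psi>) \<le> C / 2 ^ j"
    if cw: "chart_wavelet a m \<eta> \<psi>" for m \<eta> \<psi>
  proof -
    let ?r = "vabs (\<pi> powi m)"
    obtain b where b: "nonzero_set \<psi> \<subseteq> fst a" "snd a ` nonzero_set \<psi> = kball b ?r"
      using cw unfolding chart_wavelet_def by blast
    then have sub: "kball b ?r \<subseteq> snd a ` fst a" by blast
    \<comment> \<open>the ball contains two points at distance at least its radius\<close>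
    let ?b' = "b + (\<chi> i. \<pi> powi m)"
    have "b \<in> kball b ?r" "?b' \<in> kball b ?r" by (simp_all add: kball_iff)
    then have "dist z0 b \<le> e" "dist z0 ?b' \<le> e" using sub e by blast+
    then have "dist ?b' b \<le> 2 * e"
      using dist_triangle3[of ?b' b z0] by linarith
    moreover have "dist (?b' $ i) (b $ i) = ?r" for i
      by (simp add: dist_vabs)
    ultimately have "?r \<le> 2 * e"
      using dist_vec_nth_le[of ?b' undefined b] by (metis order_trans)
    then have "m0 \<le> m"
      using m0 pi_pow(5)[of m m0] by linarith
    then obtain j where j: "m = m0 + int j"
      by (metis zle_iff_zadd)
    have "emeasure \<mu> (nonzero_set \<psi>) \<le> ennreal (max V 0) * emeasure H (kball b ?r)"
      unfolding b(2)[symmetric]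
      using V b(1) by (intro emeasure_le_density[OF a chart_wavelet_borel[OF cw]]) force+
    also have "emeasure H (kball b ?r) = ennreal (measure H (kball b ?r))"
      using emeasure_kball_pi_pow[of b m] by (intro emeasure_eq_ennreal_measure) auto
    finally have "measure \<mu> (nonzero_set \<psi>) \<le> max V 0 * measure H (kball b ?r)"
      by (simp add: emeasure_eq_measure flip: ennreal_mult')
    also have "\<dots> \<le> max V 0 * (measure H (kball 0 (vabs (\<pi> powi m0))) / 2 ^ j)"
      unfolding j by (intro mult_left_mono measure_kball_pi_pow_decay) auto
    finally show ?thesis using j by (auto simp: C_def)
  qed
  then show thesis by (rule that)
qed

text \<open>The supports of the wavelets of one chart and level have bounded total volume while their
  individual volumes decay geometrically with the level.\<close>

lemma summable_measure_sq_in_chart: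
  assumes "a \<in> A"
  shows "(\<lambda>\<psi>. (measure \<mu> (nonzero_set \<psi>))\<^sup>2) summable_on {\<psi>\<in>W. \<exists>m \<eta>. chart_wavelet a m \<eta> \<psi>}"
proof -
  let ?Wa = "{\<psi>\<in>W. \<exists>m \<eta>. chart_wavelet a m \<eta> \<psi>}" and ?M = "\<lambda>\<psi>. measure \<mu> (nonzero_set \<psi>)"
  obtain N where N: "0 \<le> N"
    "\<And>a m F. finite F \<Longrightarrow> F \<subseteq> W \<Longrightarrow> \<forall>\<psi>\<in>F. \<exists>\<eta>. chart_wavelet a m \<eta> \<psi>
        \<Longrightarrow> (\<Sum>\<psi>\<in>F. ?M \<psi>) \<le> N"
    by (rule level_sum_bound) (rule that)
  obtain C m0 where Cm: "\<And>m \<eta> \<psi>. chart_wavelet a m \<eta> \<psi>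
      \<Longrightarrow> \<exists>j. m = m0 + int j \<and> ?M \<psi> \<le> C / 2 ^ j"
    by (rule chart_wavelet_measure_decay[OF assms]) (rule that)
  have "\<forall>\<psi>\<in>?Wa. \<exists>j. (\<exists>\<eta>. chart_wavelet a (m0 + int j) \<eta> \<psi>) \<and> ?M \<psi> \<le> C / 2 ^ j"
    using Cm by blast
  from bchoice[OF this] obtain lev where lev: "\<And>\<psi>. \<psi> \<in> ?Wa \<Longrightarrow> \<exists>\<eta>. chart_wavelet a (m0 + int (lev \<psi>)) \<eta> \<psi>"
      "\<And>\<psi>. \<psi> \<in> ?Wa \<Longrightarrow> ?M \<psi> \<le> C / 2 ^ lev \<psi>"
    by blast
  define D where "D = max C 0"
  have "(\<Sum>\<psi>\<in>F. (?M \<psi>)\<^sup>2) \<le> 2 * D * N" if F: "F \<subseteq> ?Wa" "finite F" for F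
  proof -
    have level: "(\<Sum>\<psi> | \<psi> \<in> F \<and> lev \<psi> = j. (?M \<psi>)\<^sup>2) \<le> D * N * (1 / 2) ^ j" for j
    proof -
      let ?F = "{\<psi>\<in>F. lev \<psi> = j}"
      have le: "?M \<psi> \<le> D / 2 ^ j" if "\<psi> \<in> ?F" for \<psi>
      proof -
        have "?M \<psi> \<le> C / 2 ^ j" using lev(2)[of \<psi>] that F(1) by auto
        also have "\<dots> \<le> D / 2 ^ j" by (intro divide_right_mono) (auto simp: D_def)
        finally show ?thesis .
      qed
      have "(\<Sum>\<psi>\<in>?F. (?M \<psi>)\<^sup>2) \<le> (\<Sum>\<psi>\<in>?F. D / 2 ^ j * ?M \<psi>)"
        unfolding power2_eq_square using le by (intro sum_mono mult_right_mono) auto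
      also have "\<dots> = D / 2 ^ j * (\<Sum>\<psi>\<in>?F. ?M \<psi>)"
        by (simp add: sum_distrib_left)
      also have "\<dots> \<le> D / 2 ^ j * N"
      proof (intro mult_left_mono N(2)[of _ a "m0 + int j"] ballI)
        show "finite ?F" "?F \<subseteq> W" "0 \<le> D / 2 ^ j" using F by (auto simp: D_def)
        fix \<psi> assume "\<psi> \<in> ?F"
        then have "\<psi> \<in> ?Wa" "lev \<psi> = j" using F(1) by blast+
        then show "\<exists>\<eta>. chart_wavelet a (m0 + int j) \<eta> \<psi>" using lev(1)[of \<psi>] by blast
      qed
      finally show ?thesis by (simp add: power_divide)
    qed
    have "(\<Sum>\<psi>\<in>F. (?M \<psi>)\<^sup>2) = (\<Sum>j\<in>lev ` F. \<Sum>\<psi> | \<psi> \<in> F \<and> lev \<psi> = j. (?M \<psi>)\<^sup>2)"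
      using F(2) by (rule sum.image_gen)
    also have "\<dots> \<le> (\<Sum>j\<in>lev ` F. D * N * (1 / 2) ^ j)"
      by (intro sum_mono level)
    also have "\<dots> \<le> (\<Sum>j. D * N * (1 / 2) ^ j)"
      using F(2) N(1) by (intro sum_le_suminf summable_mult summable_geometric) (auto simp: D_def)
    also have "\<dots> = 2 * D * N"
      by (subst suminf_mult) (auto simp: suminf_geometric)
    finally show ?thesis .
  qed
  then show ?thesis
    by (intro nonneg_bdd_above_summable_on bdd_aboveI) auto
qed

lemma summable_measure_sq: "(\<lambda>\<psi>. (measure \<mu> (nonzero_set \<psi>))\<^sup>2) summable_on W"
proof -
  let ?W = "\<lambda>a. {\<psi>\<in>W. \<exists>m \<eta>. chart_wavelet a m \<eta> \<psi>}"
  have "(\<lambda>\<psi>. (measure \<mu> (nonzero_set \<psi>))\<^sup>2) summable_on (\<Union>a\<in>A'. ?W a)" if "A' \<subseteq> A" for A'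
    using finite_subset[OF that finite_atlas] that
    by (induction A') (auto intro!: summable_on_union summable_measure_sq_in_chart)
  from this[OF order_refl] have union: "(\<lambda>\<psi>. (measure \<mu> (nonzero_set \<psi>))\<^sup>2) summable_on (\<Union>a\<in>A. ?W a)" .
  have "W \<subseteq> (\<Union>a\<in>A. ?W a)"
  proof
    fix \<psi> assume \<psi>: "\<psi> \<in> W"
    obtain a m \<eta> where "chart_wavelet a m \<eta> \<psi>"
      by (rule wavelet_cases[OF \<psi>]) (rule that)
    moreover from this have "a \<in> A" by (simp add: chart_wavelet_def)
    ultimately show "\<psi> \<in> (\<Union>a\<in>A. ?W a)" using \<psi> by blast
  qed
  with union show ?thesis by (rule summable_on_subset)
qed

lemma finitely_many_large_supports:
  assumes "0 < \<epsilon>"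
  shows "finite {\<psi>\<in>W. \<epsilon> \<le> measure \<mu> (nonzero_set \<psi>)}"
proof (rule ccontr)
  let ?f = "\<lambda>\<psi>. (measure \<mu> (nonzero_set \<psi>))\<^sup>2" and ?S = "{\<psi>\<in>W. \<epsilon> \<le> measure \<mu> (nonzero_set \<psi>)}"
  assume "infinite ?S"
  obtain k :: nat where k: "infsum ?f W < of_nat k * \<epsilon>\<^sup>2"
    using reals_Archimedean3[of "\<epsilon>\<^sup>2"] assms by auto
  obtain G where G: "finite G" "card G = k" "G \<subseteq> ?S"
    using infinite_arbitrarily_large[OF \<open>infinite ?S\<close>] by blast
  have "of_nat k * \<epsilon>\<^sup>2 = (\<Sum>\<psi>\<in>G. \<epsilon>\<^sup>2)" using G(2) by simp
  also have "\<dots> \<le> (\<Sum>\<psi>\<in>G. ?f \<psi>)"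
    using G(3) assms by (intro sum_mono power_mono) auto
  also have "\<dots> \<le> infsum ?f W"
    using G(1,3) by (intro finite_sum_le_infsum summable_measure_sq) auto
  finally show False using k by simp
qed

text \<open>A support containing two points contains their join, and the join of distinct points has positive
  volume.\<close>

lemma finite_wavelets_through_two_points:
  assumes "x \<noteq> y"
  shows "finite {\<psi>\<in>W. \<psi> x \<noteq> 0 \<and> \<psi> y \<noteq> 0}"
proof (rule finite_subset[OF _ finitely_many_large_supports[OF measure_join_pos[OF assms]]], clarify)
  fix \<psi> assume \<psi>: "\<psi> \<in> W" "\<psi> x \<noteq> 0" "\<psi> y \<noteq> 0"
  obtain r where "is_ball A r (nonzero_set \<psi>)"
    by (rule wavelet_cases[OF \<psi>(1)]) (rule that)
  then show "measure \<mu> (join_set A x y) \<le> measure \<mu> (nonzero_set \<psi>)"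
    using \<psi> by (intro measure_join_le) (auto simp: nonzero_set_def)
qed

section \<open>The eigenvalues of wavelets on small balls\<close>

text \<open>The density is constant on balls of small radius. Smallness of the radius follows from smallness
  of the volume because the density is bounded below.\<close>

lemma density_constant_on_small_supports:
  assumes a: "a \<in> A"
  obtains \<epsilon> where "0 < \<epsilon>" "\<And>m \<eta> \<psi>. chart_wavelet a m \<eta> \<psi> \<Longrightarrow> measure \<mu> (nonzero_set \<psi>) < \<epsilon>
      \<Longrightarrow> \<exists>v. \<forall>z\<in>snd a ` nonzero_set \<psi>. vabs (\<omega> a z) = v"
proof -
  obtain \<delta> v where \<delta>: "0 < \<delta>" and v: "0 < v" "\<And>z. z \<in> snd a ` fst a \<Longrightarrow> v \<le> vabs (\<omega> a z)"
    and const: "\<And>z z'. z \<in> snd a ` fst a \<Longrightarrow> z' \<in> kball z \<delta> \<Longrightarrow> vabs (\<omega> a z') = vabs (\<omega> a z)"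
    by (rule density_bounds[OF a]) (rule that)
  obtain k where k: "vabs (\<pi> powi int k) \<le> \<delta>"
    by (rule small_uniformiser_pow[OF uniformiser \<delta>])
  define \<epsilon> where "\<epsilon> = v * measure H (kball 0 (vabs (\<pi> powi int k)))"
  have fin: "emeasure H (kball b (vabs (\<pi> powi m))) = ennreal (measure H (kball b (vabs (\<pi> powi m))))" for b m
    using emeasure_kball_pi_pow[of b m] by (intro emeasure_eq_ennreal_measure) auto
  have "0 < \<epsilon>"
    using v(1) emeasure_kball_pi_pow[of 0 "int k"] unfolding fin \<epsilon>_def by simp
  moreover have "\<exists>v. \<forall>z\<in>snd a ` nonzero_set \<psi>. vabs (\<omega> a z) = v"
    if cw: "chart_wavelet a m \<eta> \<psi>" and small: "measure \<mu> (nonzero_set \<psi>) < \<epsilon>" for m \<eta> \<psi>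
  proof -
    obtain b where b: "nonzero_set \<psi> \<subseteq> fst a" "snd a ` nonzero_set \<psi> = kball b (vabs (\<pi> powi m))"
      using cw unfolding chart_wavelet_def by blast
    have "int k \<le> m"
    proof (rule ccontr)
      assume "\<not> int k \<le> m"
      then have le: "vabs (\<pi> powi int k) \<le> vabs (\<pi> powi m)"
        by (intro pi_pow(5)) simp
      have "ennreal \<epsilon> = ennreal v * emeasure H (kball b (vabs (\<pi> powi int k)))"
        using v(1) by (subst emeasure_kball_centre) (simp add: \<epsilon>_def fin[of 0 "int k"] ennreal_mult' del: power_int_of_nat)
      also have "\<dots> \<le> ennreal v * emeasure H (kball b (vabs (\<pi> powi m)))"
        using kball_mono[OF le] by (intro mult_left_mono emeasure_mono) auto
      also have "\<dots> \<le> emeasure \<mu> (nonzero_set \<psi>)"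
        unfolding b(2)[symmetric] using b(1) v(2)
        by (intro emeasure_ge_density[OF a chart_wavelet_borel[OF cw]]) auto
      finally show False
        using small by (simp add: emeasure_eq_measure)
    qed
    then have r: "vabs (\<pi> powi m) \<le> \<delta>"
      using pi_pow(5)[of "int k" m] k by linarith
    have "b \<in> kball b (vabs (\<pi> powi m))" by (simp add: kball_iff)
    then have "b \<in> snd a ` fst a" using b by blast
    then show ?thesis
      using const kball_mono[OF r, of b] unfolding b(2) by blast
  qed
  ultimately show thesis by (rule that)
qed

lemma wavelet_measurable [measurable]: "\<psi> \<in> W \<Longrightarrow> \<psi> \<in> borel_measurable \<mu>"
  using W_orthonormal by (simp add: L2_orthonormal_def square_integrable_def)

lemma wavelet_integrable:
  assumes "\<psi> \<in> W"
  shows "integrable \<mu> \<psi>"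
proof -
  obtain C where C: "\<And>x. x \<in> nonzero_set \<psi> \<Longrightarrow> (norm (\<psi> x))\<^sup>2 = C"
    by (rule wavelet_cases[OF assms]) (rule that)
  have "norm (\<psi> x) \<le> sqrt \<bar>C\<bar>" for x
    using C[of x] by (cases "\<psi> x = 0") (auto simp: nonzero_set_def real_le_rsqrt)
  then show ?thesis
    using wavelet_measurable[OF assms] by (intro integrable_const_bound[of _ "sqrt \<bar>C\<bar>"]) auto
qed

text \<open>Where the density is constant, translating the ball by a vector on which the phase is not
  \<open>1\<close> preserves the measure but multiplies the wavelet by that phase.\<close>

lemma wavelet_integral_zero:
  assumes W: "\<psi> \<in> W" and cw: "chart_wavelet a m \<eta> \<psi>"
    and density: "\<And>z. z \<in> snd a ` nonzero_set \<psi> \<Longrightarrow> vabs (\<omega> a z) = v"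
  shows "(LINT x|\<mu>. \<psi> x) = 0"
proof -
  define B where "B = nonzero_set \<psi>"
  obtain b c where b: "B \<subseteq> fst a" "snd a ` B = kball b (vabs (\<pi> powi m))"
      and c: "\<And>x. x \<in> B \<Longrightarrow> \<psi> x = c * phase m \<eta> (snd a x)"
    and \<eta>: "\<forall>i. \<eta> $ i \<in> int_ring" "\<exists>i. \<eta> $ i \<notin> (\<lambda>u. \<pi> * u) ` int_ring"
    using cw unfolding chart_wavelet_def B_def by blast
  have a: "a \<in> A" using cw by (simp add: chart_wavelet_def)
  have B: "B \<in> sets borel" unfolding B_def by (rule chart_wavelet_borel[OF cw])
  obtain h where h: "h \<in> kball 0 (vabs (\<pi> powi m))" "phase m \<eta> h \<noteq> 1"
    by (rule phase_nontrivial[OF \<eta>])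
  have emeasure_B: "emeasure \<mu> E = ennreal v * emeasure H (snd a ` E)"
    if "E \<in> sets borel" "E \<subseteq> B" for E
    using that b(1) density unfolding B_def
    by (intro antisym emeasure_le_density[OF a] emeasure_ge_density[OF a]) (auto simp: image_subset_iff)
  let ?K = "kball b (vabs (\<pi> powi m))" and ?g = "inv_into (fst a) (snd a)"
  have "h + b \<in> ?K"
    using h(1) by (simp add: kball_iff)
  then have shift: "(+) h ` ?K = ?K"
    unfolding kball_translate by (rule kball_recentre)
  \<comment> \<open>translation by \<open>h\<close>, carried over to the ball in the manifold\<close>
  define T where "T x = ?g (h + snd a x)" for x
  have T: "T x \<in> B" "snd a (T x) = h + snd a x" if "x \<in> B" for x
  proof -
    have "h + snd a x \<in> snd a ` B"
      using that b(2) shift by blast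
    then obtain x' where x': "x' \<in> B" "snd a x' = h + snd a x" by (metis imageE)
    have "x' \<in> fst a" using x'(1) b(1) by blast
    then have "T x = x'"
      unfolding T_def x'(2)[symmetric] by (rule inv_into_f_f[OF chart(4)[OF a]])
    with x' show "T x \<in> B" "snd a (T x) = h + snd a x" by simp_all
  qed
  define N where "N = restrict_space \<mu> B"
  have N: "space N = B" "sets N = sets (restrict_space borel B)"
    unfolding N_def using sets_restrict_space_cong[OF sets_mu]
    by (simp_all add: space_restrict_space)
  have emeasure_N: "emeasure N E = emeasure \<mu> E" if "E \<subseteq> B" for E
    using that B unfolding N_def by (intro emeasure_restrict_space) auto
  have T_cont: "continuous_on B T"
  proof -
    have "continuous_on B (\<lambda>x. h + snd a x)"
      using continuous_on_compose[OF continuous_on_subset[OF chart(3)[OF a] b(1)]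
          continuous_on_subset[OF continuous_translate subset_UNIV]] by (simp add: o_def)
    moreover have "(\<lambda>x. h + snd a x) ` B \<subseteq> snd a ` fst a"
    proof clarify
      fix x assume "x \<in> B"
      then have "h + snd a x = snd a (T x)" "T x \<in> fst a" using T b(1) by auto
      then show "h + snd a x \<in> snd a ` fst a" by simp
    qed
    ultimately show ?thesis
      unfolding T_def using continuous_on_compose2[OF chart(5)[OF a]] by blast
  qed
  have T_meas: "T \<in> measurable N N"
  proof -
    have "T \<in> borel_measurable (restrict_space borel B)"
      using T_cont by (rule borel_measurable_continuous_on_restrict)
    then have "T \<in> measurable N \<mu>"
      using N(2) by (metis measurable_cong_sets sets_mu)
    then show ?thesis
      unfolding N_def using T(1) N(1) by (intro measurable_restrict_space2) (auto simp: N_def)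
  qed
  have "distr N N T = N"
  proof (rule measure_eqI)
    fix E assume "E \<in> sets (distr N N T)"
    then have E: "E \<in> sets N" by simp
    then have E': "E \<subseteq> B" "E \<in> sets borel"
      using B unfolding N(2) by (auto simp: sets_restrict_space_iff)
    let ?P = "T -` E \<inter> B"
    have "?P \<in> sets N"
      using measurable_sets[OF T_meas E] N(1) by simp
    then have P: "?P \<subseteq> B" "?P \<in> sets borel"
      using B unfolding N(2) by (auto simp: sets_restrict_space_iff)
    have "(+) h ` (snd a ` ?P) = snd a ` E"
    proof
      show "(+) h ` (snd a ` ?P) \<subseteq> snd a ` E"
      proof clarify
        fix x assume x: "x \<in> B" "T x \<in> E"
        then show "h + snd a x \<in> snd a ` E" using T(2)[OF x(1)] by force
      qed
      show "snd a ` E \<subseteq> (+) h ` (snd a ` ?P)"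
      proof clarify
        fix y assume y: "y \<in> E"
        then have "snd a y \<in> (+) h ` snd a ` B" using E'(1) b(2) shift by blast
        then obtain x where x: "x \<in> B" "snd a y = h + snd a x" by blast
        then have "snd a (T x) = snd a y" using T(2) by simp
        then have "T x = y"
          using T(1)[OF x(1)] y E'(1) b(1) chart(4)[OF a] by (auto dest!: inj_onD)
        then have "x \<in> ?P" using x(1) y by simp
        then show "snd a y \<in> (+) h ` (snd a ` ?P)" using x(2) by blast
      qed
    qed
    then have "emeasure H (snd a ` E) = emeasure H (snd a ` ?P)"
      using translation_invariant[OF chart_image_borel[OF a P(2)], of h] P(1) b(1) by auto
    then have "emeasure \<mu> E = emeasure \<mu> ?P"
      using emeasure_B E' P by simp
    then show "emeasure (distr N N T) E = emeasure N E"
      using E E'(1) N(1) P(1) by (simp add: emeasure_distr[OF T_meas] emeasure_N)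
  qed simp
  then have "(LINT x|N. \<psi> x) = (LINT x|distr N N T. \<psi> x)" by simp
  also have "\<dots> = (LINT x|N. \<psi> (T x))"
    using T_meas by (rule integral_distr)
      (simp add: N_def measurable_restrict_space1 wavelet_measurable[OF W])
  also have "\<dots> = (LINT x|N. phase m \<eta> h * \<psi> x)"
    using T c by (intro Bochner_Integration.integral_cong) (auto simp: N(1) phase_add)
  also have "\<dots> = phase m \<eta> h * (LINT x|N. \<psi> x)" by simp
  finally have "(LINT x|N. \<psi> x) = 0"
    using h(2) by simp
  moreover have "(LINT x|N. \<psi> x) = (LINT x|\<mu>. indicator B x *\<^sub>R \<psi> x)"
    unfolding N_def using B by (intro integral_restrict_space) simp
  moreover have "indicator B x *\<^sub>R \<psi> x = \<psi> x" for x
    by (auto simp: B_def nonzero_set_def indicator_def)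
  ultimately show ?thesis by simp
qed

text \<open>Divide the eigenvalue equation at a point \<open>x\<close> of the support \<open>B\<close> by \<open>\<psi> x\<close> and take real
  parts. The integrand becomes nonnegative, so the integral may be restricted to \<open>B\<close>, where
  the distance is at most the volume of \<open>B\<close>; there \<open>1 - Re (\<psi> y / \<psi> x)\<close> integrates
  to the volume of \<open>B\<close> because \<open>\<psi>\<close> has mean zero.\<close>

lemma eigenvalue_lower_bound:
  assumes W: "\<psi> \<in> W" and mean: "(LINT x|\<mu>. \<psi> x) = 0" and s: "0 \<le> s"
    and eig: "eigenvalue_for A \<mu> s \<psi> l"
  shows "measure \<mu> (nonzero_set \<psi>) powr (1 - s) \<le> l"
proof -
  define B where "B = nonzero_set \<psi>"
  obtain r where ball: "is_ball A r B" and pos: "0 < measure \<mu> B"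
    and norm2: "\<And>x. x \<in> B \<Longrightarrow> (norm (\<psi> x))\<^sup>2 = 1 / measure \<mu> B"
    by (rule wavelet_cases[OF W, folded B_def]) (rule that)
  have B: "B \<in> sets \<mu>" using is_ball_closed[OF ball] by simp
  obtain x where x: "x \<in> B"
    using pos by (metis ex_in_conv less_irrefl measure_empty)
  have nz: "\<psi> x \<noteq> 0" using x by (simp add: B_def nonzero_set_def)
  have out: "\<psi> y = 0" if "y \<notin> B" for y using that by (simp add: B_def nonzero_set_def)
  define k where "k y = geodetic_dist A \<mu> x y powr (- s)" for y
  \<comment> \<open>\<open>k y * u y\<close> is the real part of the integrand of the operator at \<open>x\<close>, divided by \<open>\<psi> x\<close>\<close>
  define u where "u y = 1 - Re (\<psi> y / \<psi> x)" for y
  have u_nonneg: "0 \<le> u y" for y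
  proof (cases "y \<in> B")
    case True
    then have "norm (\<psi> y) = norm (\<psi> x)"
      using norm2 x by (metis norm_ge_zero power2_eq_imp_eq)
    then have "norm (\<psi> y / \<psi> x) = 1" using nz by (simp add: norm_divide)
    then show ?thesis
      using complex_Re_le_cmod[of "\<psi> y / \<psi> x"] by (simp add: u_def)
  qed (simp add: u_def out)
  have int1: "integrable \<mu> (\<lambda>y. complex_of_real (k y) * (\<psi> x - \<psi> y))"
    and val1: "(LINT y|\<mu>. complex_of_real (k y) * (\<psi> x - \<psi> y)) = complex_of_real l * \<psi> x"
    using eig unfolding eigenvalue_for_def Delta_op_def k_def by auto
  have eq: "k y * u y = Re (complex_of_real (k y) * (\<psi> x - \<psi> y) / \<psi> x)" for y
  proof -
    have "complex_of_real (k y) * (\<psi> x - \<psi> y) / \<psi> x = complex_of_real (k y) * (1 - \<psi> y / \<psi> x)"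
      using nz by (simp add: field_simps)
    then show ?thesis by (simp add: u_def)
  qed
  have int2: "integrable \<mu> (\<lambda>y. k y * u y)"
    unfolding eq using int1 by (intro integrable_Re integrable_divide) auto
  have "(LINT y|\<mu>. k y * u y) = Re (LINT y|\<mu>. complex_of_real (k y) * (\<psi> x - \<psi> y) / \<psi> x)"
    unfolding eq using int1 by (intro integral_Re integrable_divide) auto
  also have "\<dots> = l"
    using nz by (simp add: val1)
  finally have val2: "(LINT y|\<mu>. k y * u y) = l" .
  let ?f = "\<lambda>y. measure \<mu> B powr (- s) * (indicator B y - Re (\<psi> y / \<psi> x))"
  have intf: "integrable \<mu> ?f"
    using B wavelet_integrable[OF W] by (intro integrable_mult_right integrable_diff
        integrable_Re integrable_divide) (auto simp: emeasure_eq_measure)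
  have "(LINT y|\<mu>. Re (\<psi> y / \<psi> x)) = Re (LINT y|\<mu>. \<psi> y / \<psi> x)"
    using wavelet_integrable[OF W] by (intro integral_Re integrable_divide) auto
  then have mean': "(LINT y|\<mu>. Re (\<psi> y / \<psi> x)) = 0"
    using mean by simp
  have "integrable \<mu> (\<lambda>y. Re (\<psi> y / \<psi> x))"
    using wavelet_integrable[OF W] by (intro integrable_Re integrable_divide) auto
  then have "(LINT y|\<mu>. ?f y) = measure \<mu> B powr (- s) * measure \<mu> B"
    using B mean' by (simp add: emeasure_eq_measure)
  also have "\<dots> = measure \<mu> B powr (1 - s)"
    using pos by (simp add: powr_diff powr_minus divide_inverse)
  finally have "measure \<mu> B powr (1 - s) = (LINT y|\<mu>. ?f y)" by simp
  also have "\<dots> \<le> (LINT y|\<mu>. k y * u y)"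
  proof (rule integral_mono[OF intf int2])
    fix y
    show "?f y \<le> k y * u y"
    proof (cases "y \<in> B \<and> y \<noteq> x")
      case True
      then have d: "0 < geodetic_dist A \<mu> x y" "geodetic_dist A \<mu> x y \<le> measure \<mu> B"
        using geodetic_dist_in_ball[OF ball x] by auto
      then have "measure \<mu> B powr (- s) \<le> k y"
        unfolding k_def using s by (intro powr_mono2') auto
      then have "measure \<mu> B powr (- s) * u y \<le> k y * u y"
        using u_nonneg by (intro mult_right_mono)
      then show ?thesis using True by (simp add: u_def)
    next
      case False
      \<comment> \<open>both sides vanish at \<open>y = x\<close>, whatever the value of the distance there; outside the ball
        the left-hand side vanishes\<close>
      then have "indicator B y - Re (\<psi> y / \<psi> x) = (0 :: real)"
        using nz out x by (cases "y = x") auto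
      then show ?thesis using u_nonneg by (simp add: k_def)
    qed
  qed
  finally show ?thesis using val2 by (simp add: B_def)
qed

lemma eigenvalue_lower_bound_almost_all:
  assumes s: "0 \<le> s" and eig: "\<forall>\<psi>\<in>W. eigenvalue_for A \<mu> s \<psi> (lam \<psi>)"
  shows "finite {\<psi>\<in>W. \<not> measure \<mu> (nonzero_set \<psi>) powr (1 - s) \<le> lam \<psi>}"
proof -
  have "\<exists>\<epsilon>>0. \<forall>m \<eta> \<psi>. chart_wavelet a m \<eta> \<psi> \<longrightarrow> measure \<mu> (nonzero_set \<psi>) < \<epsilon>
      \<longrightarrow> (\<exists>v. \<forall>z\<in>snd a ` nonzero_set \<psi>. vabs (\<omega> a z) = v)" if a: "a \<in> A" for a
    by (rule density_constant_on_small_supports[OF a]) blast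
  then have "\<forall>a\<in>A. \<exists>\<epsilon>>0. \<forall>m \<eta> \<psi>. chart_wavelet a m \<eta> \<psi> \<longrightarrow> measure \<mu> (nonzero_set \<psi>) < \<epsilon>
      \<longrightarrow> (\<exists>v. \<forall>z\<in>snd a ` nonzero_set \<psi>. vabs (\<omega> a z) = v)" by blast
  from bchoice[OF this] obtain \<epsilon> where \<epsilon>: "\<And>a. a \<in> A \<Longrightarrow> 0 < \<epsilon> a"
    "\<And>a m \<eta> \<psi>. a \<in> A \<Longrightarrow> chart_wavelet a m \<eta> \<psi> \<Longrightarrow> measure \<mu> (nonzero_set \<psi>) < \<epsilon> a
      \<Longrightarrow> \<exists>v. \<forall>z\<in>snd a ` nonzero_set \<psi>. vabs (\<omega> a z) = v" by blast
  have "{\<psi>\<in>W. \<not> measure \<mu> (nonzero_set \<psi>) powr (1 - s) \<le> lam \<psi>}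
      \<subseteq> (\<Union>a\<in>A. {\<psi>\<in>W. \<epsilon> a \<le> measure \<mu> (nonzero_set \<psi>)})"
  proof
    fix \<psi> assume \<psi>: "\<psi> \<in> {\<psi>\<in>W. \<not> measure \<mu> (nonzero_set \<psi>) powr (1 - s) \<le> lam \<psi>}"
    then have W: "\<psi> \<in> W" by simp
    obtain a m \<eta> where cw: "chart_wavelet a m \<eta> \<psi>"
      by (rule wavelet_cases[OF W]) (rule that)
    then have a: "a \<in> A" by (simp add: chart_wavelet_def)
    have "\<not> measure \<mu> (nonzero_set \<psi>) < \<epsilon> a"
    proof
      assume "measure \<mu> (nonzero_set \<psi>) < \<epsilon> a"
      then obtain v where v: "\<And>z. z \<in> snd a ` nonzero_set \<psi> \<Longrightarrow> vabs (\<omega> a z) = v"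
        using \<epsilon>(2)[OF a cw] by blast
      have "measure \<mu> (nonzero_set \<psi>) powr (1 - s) \<le> lam \<psi>"
        using eigenvalue_lower_bound[OF W wavelet_integral_zero[OF W cw v] s] eig W by blast
      with \<psi> show False by simp
    qed
    with a W show "\<psi> \<in> (\<Union>a\<in>A. {\<psi>\<in>W. \<epsilon> a \<le> measure \<mu> (nonzero_set \<psi>)})"
      by (auto simp: not_less)
  qed
  then show ?thesis
    by (rule finite_subset) (use finite_atlas finitely_many_large_supports \<epsilon>(1) in blast)
qed

end

section \<open>Convergence of the heat kernel\<close>

text \<open>As \<open>u\<close> tends to \<open>0\<close> the exponent \<open>v = t * u powr (1 - s)\<close> tends to infinity, and \<open>exp v\<close> is at
  least \<open>(v / n) ^ n\<close>, which for \<open>n * (s - 1) > 3\<close> outweighs \<open>1 / u ^ 3\<close>.\<close>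

lemma exp_neg_power_bound:
  fixes t s U :: real
  assumes "0 < t" "1 < s"
  obtains C where "0 \<le> C" "\<And>u. 0 < u \<Longrightarrow> u \<le> U \<Longrightarrow> exp (- t * u powr (1 - s)) / u \<le> C * u\<^sup>2"
proof -
  obtain n :: nat where n: "3 < of_nat n * (s - 1)"
    using reals_Archimedean3[of "s - 1"] assms by auto
  then have "n \<noteq> 0" by (intro notI) simp
  define e where "e = of_nat n * (s - 1) - 3"
  define C where "C = (of_nat n / t) ^ n * max U 0 powr e"
  have "exp (- t * u powr (1 - s)) / u \<le> C * u\<^sup>2" if u: "0 < u" "u \<le> U" for u
  proof -
    define v where "v = t * u powr (1 - s)"
    have v: "0 < v" using assms u by (simp add: v_def)
    have "(v / of_nat n) ^ n \<le> exp (v / of_nat n) ^ n"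
    proof (rule power_mono)
      show "v / of_nat n \<le> exp (v / of_nat n)"
        using exp_ge_add_one_self[of "v / of_nat n"] by linarith
    qed (use v in simp)
    also have "\<dots> = exp v"
      using \<open>n \<noteq> 0\<close> by (simp flip: exp_of_nat_mult)
    finally have "exp (- v) \<le> inverse ((v / of_nat n) ^ n)"
      using v \<open>n \<noteq> 0\<close> by (simp add: exp_minus le_imp_inverse_le)
    also have "\<dots> = (of_nat n / t) ^ n * inverse ((u powr (1 - s)) ^ n)"
      by (simp add: v_def power_divide power_mult_distrib field_simps)
    also have "inverse ((u powr (1 - s)) ^ n) = u powr (e + 3)"
      using u by (simp add: e_def powr_power algebra_simps flip: powr_minus)
    also have "\<dots> = u powr e * u ^ 3"
      using u by (simp add: powr_add)
    also have "(of_nat n / t) ^ n * \<dots> \<le> (of_nat n / t) ^ n * (max U 0 powr e * u ^ 3)"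
      using u n assms by (intro mult_left_mono mult_right_mono powr_mono2) (auto simp: e_def)
    finally have "exp (- v) \<le> C * u ^ 3"
      by (simp add: C_def mult.assoc)
    then show ?thesis
      using u by (simp add: v_def field_simps power2_eq_square power3_eq_cube)
  qed
  moreover have "0 \<le> C" using assms by (simp add: C_def)
  ultimately show thesis by (intro that)
qed

context wavelet_system
begin

lemma heat_term_norm_le:
  assumes "\<psi> \<in> W"
  shows "norm (heat_term lam t x y \<psi>) \<le> exp (- t * lam \<psi>) / measure \<mu> (nonzero_set \<psi>)"
proof -
  let ?M = "measure \<mu> (nonzero_set \<psi>)"
  have norm2: "\<And>x. x \<in> nonzero_set \<psi> \<Longrightarrow> (norm (\<psi> x))\<^sup>2 = 1 / ?M"
    by (rule wavelet_cases[OF assms]) blast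
  have le: "norm (\<psi> x) \<le> sqrt (1 / ?M)" for x
    using norm2[of x] by (cases "\<psi> x = 0") (auto simp: nonzero_set_def intro!: real_le_rsqrt)
  have "norm (heat_term lam t x y \<psi>) = exp (- t * lam \<psi>) * (norm (\<psi> x) * norm (\<psi> y))"
    by (simp add: heat_term_def norm_mult)
  also have "\<dots> \<le> exp (- t * lam \<psi>) * (sqrt (1 / ?M) * sqrt (1 / ?M))"
    using le by (intro mult_left_mono mult_mono) auto
  also have "sqrt (1 / ?M) * sqrt (1 / ?M) = 1 / ?M" by simp
  finally show ?thesis by simp
qed

text \<open>The square of the volume dominates the heat terms of all wavelets that satisfy the eigenvalue
  bound; the other wavelets are finite in number.\<close>

lemma heat_bound_summable:
  assumes "0 < t" "1 < s" and eig: "\<forall>\<psi>\<in>W. eigenvalue_for A \<mu> s \<psi> (lam \<psi>)"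
  shows "(\<lambda>\<psi>. exp (- t * lam \<psi>) / measure \<mu> (nonzero_set \<psi>)) summable_on W"
proof -
  let ?M = "\<lambda>\<psi>. measure \<mu> (nonzero_set \<psi>)"
  define E where "E = {\<psi>\<in>W. \<not> ?M \<psi> powr (1 - s) \<le> lam \<psi>}"
  obtain C where C: "0 \<le> C"
    "\<And>u. 0 < u \<Longrightarrow> u \<le> measure \<mu> UNIV \<Longrightarrow> exp (- t * u powr (1 - s)) / u \<le> C * u\<^sup>2"
    by (rule exp_neg_power_bound[OF assms(1,2)]) (rule that)
  have "(\<lambda>\<psi>. exp (- t * lam \<psi>) / ?M \<psi>) summable_on (W - E)"
  proof (rule summable_on_comparison_test)
    show "(\<lambda>\<psi>. C * (?M \<psi>)\<^sup>2) summable_on (W - E)"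
      by (intro summable_on_cmult_right summable_on_subset[OF summable_measure_sq]) auto
    fix \<psi> assume \<psi>: "\<psi> \<in> W - E"
    have pos: "0 < ?M \<psi>"
      by (rule wavelet_cases[of \<psi>]) (use \<psi> in auto)
    have "exp (- t * lam \<psi>) \<le> exp (- t * ?M \<psi> powr (1 - s))"
      using \<psi> assms(1) by (auto simp: E_def)
    then have "exp (- t * lam \<psi>) / ?M \<psi> \<le> exp (- t * ?M \<psi> powr (1 - s)) / ?M \<psi>"
      by (intro divide_right_mono) auto
    also have "\<dots> \<le> C * (?M \<psi>)\<^sup>2"
      using pos bounded_measure[of "nonzero_set \<psi>"] by (intro C(2)) auto
    finally show "exp (- t * lam \<psi>) / ?M \<psi> \<le> C * (?M \<psi>)\<^sup>2" .
  qed auto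
  moreover have "(\<lambda>\<psi>. exp (- t * lam \<psi>) / ?M \<psi>) summable_on E"
    unfolding E_def using assms(2) eig
    by (intro summable_on_finite eigenvalue_lower_bound_almost_all) auto
  ultimately have "(\<lambda>\<psi>. exp (- t * lam \<psi>) / ?M \<psi>) summable_on (W - E \<union> E)"
    by (rule summable_on_union)
  then show ?thesis
    by (rule summable_on_subset) auto
qed

lemma heat_terms_summable_off_diagonal:
  assumes "x \<noteq> y"
  shows "heat_term lam t x y summable_on W"
proof (rule finite_nonzero_values_imp_summable_on)
  show "finite {\<psi> \<in> W. heat_term lam t x y \<psi> \<noteq> 0}"
    by (rule finite_subset[OF _ finite_wavelets_through_two_points[OF assms]])
       (auto simp: heat_term_def)
qed

text \<open>The summable majorant does not depend on the points, so the kernel is bounded, and a bounded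
  measurable function on a space of finite measure is square integrable.\<close>

lemma heat_kernel_exists_square_integrable:
  assumes "0 < t" "1 < s" and eig: "\<forall>\<psi>\<in>W. eigenvalue_for A \<mu> s \<psi> (lam \<psi>)"
  shows "heat_term lam t x y summable_on W"
    and "square_integrable (\<mu> \<Otimes>\<^sub>M \<mu>) (\<lambda>(x, y). heat_kernel W lam t x y)"
proof -
  let ?b = "\<lambda>\<psi>. exp (- t * lam \<psi>) / measure \<mu> (nonzero_set \<psi>)"
  have b: "?b summable_on W"
    using heat_bound_summable assms by blast
  have abs: "(\<lambda>\<psi>. norm (heat_term lam t x y \<psi>)) summable_on W" for x y
    using b heat_term_norm_le by (rule Infinite_Sum.abs_summable_on_comparison_test')
  have summ: "heat_term lam t x y summable_on W" for x y
    using abs by (rule abs_summable_summable)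
  then show "heat_term lam t x y summable_on W" .
  have bound: "norm (heat_kernel W lam t x y) \<le> 1 + infsum ?b W" for x y
  proof -
    have "norm (infsum (heat_term lam t x y) W) \<le> infsum ?b W"
      using has_sum_infsum[OF summ] has_sum_infsum[OF b] heat_term_norm_le by (rule norm_infsum_le)
    then show ?thesis
      unfolding heat_kernel_def using norm_triangle_ineq[of 1 "infsum (heat_term lam t x y) W"]
      by simp
  qed
  \<comment> \<open>the kernel is the limit of its partial sums over the finitely many wavelets with
    supports of volume at least \<open>1 / (n + 1)\<close>\<close>
  define G where "G n = {\<psi>\<in>W. 1 / real (Suc n) \<le> measure \<mu> (nonzero_set \<psi>)}" for n
  have fin: "finite (G n)" for n
    unfolding G_def by (rule finitely_many_large_supports) simp
  have "filterlim G (finite_subsets_at_top W) sequentially"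
    unfolding filterlim_finite_subsets_at_top
  proof (intro allI impI)
    fix X assume X: "finite X \<and> X \<subseteq> W"
    have "eventually (\<lambda>n. \<psi> \<in> G n) sequentially" if "\<psi> \<in> X" for \<psi>
    proof -
      have W: "\<psi> \<in> W" using that X by blast
      have "0 < measure \<mu> (nonzero_set \<psi>)"
        by (rule wavelet_cases[OF W])
      then have "eventually (\<lambda>n. 1 / real (Suc n) < measure \<mu> (nonzero_set \<psi>)) sequentially"
        using LIMSEQ_inverse_real_of_nat by (auto simp: inverse_eq_divide dest: order_tendstoD(2))
      then show ?thesis
        by eventually_elim (use W in \<open>auto simp: G_def\<close>)
    qed
    then have "eventually (\<lambda>n. \<forall>\<psi>\<in>X. \<psi> \<in> G n) sequentially"
      using X by (intro eventually_ball_finite) auto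
    then show "eventually (\<lambda>n. finite (G n) \<and> X \<subseteq> G n \<and> G n \<subseteq> W) sequentially"
      by eventually_elim (use fin in \<open>auto simp: G_def\<close>)
  qed
  then have lim: "(\<lambda>n. sum (heat_term lam t x y) (G n)) \<longlonglongrightarrow> infsum (heat_term lam t x y) W" for x y
    using infsum_tendsto[OF summ[of x y]] by (rule filterlim_compose[rotated])
  have meas: "(\<lambda>(x, y). heat_kernel W lam t x y) \<in> borel_measurable (\<mu> \<Otimes>\<^sub>M \<mu>)"
  proof (rule borel_measurable_LIMSEQ_metric)
    fix n
    have "(\<lambda>z. 1 + (\<Sum>\<psi>\<in>G n. heat_term lam t (fst z) (snd z) \<psi>)) \<in> borel_measurable (\<mu> \<Otimes>\<^sub>M \<mu>)"
    proof (intro borel_measurable_add borel_measurable_sum borel_measurable_const)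
      fix \<psi> assume "\<psi> \<in> G n"
      then have [measurable]: "\<psi> \<in> borel_measurable \<mu>"
        by (auto simp: G_def wavelet_measurable)
      have [measurable]: "(\<lambda>x. cnj (\<psi> x)) \<in> borel_measurable \<mu>"
        by (rule borel_measurable_continuous_onI[THEN measurable_compose[rotated]])
           (auto intro: continuous_intros)
      show "(\<lambda>z. heat_term lam t (fst z) (snd z) \<psi>) \<in> borel_measurable (\<mu> \<Otimes>\<^sub>M \<mu>)"
        unfolding heat_term_def by measurable
    qed
    then show "(\<lambda>z. 1 + (\<Sum>\<psi>\<in>G n. heat_term lam t (fst z) (snd z) \<psi>)) \<in> borel_measurable (\<mu> \<Otimes>\<^sub>M \<mu>)" .
  next
    fix z
    show "(\<lambda>n. 1 + (\<Sum>\<psi>\<in>G n. heat_term lam t (fst z) (snd z) \<psi>))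
        \<longlonglongrightarrow> (case z of (x, y) \<Rightarrow> heat_kernel W lam t x y)"
      unfolding heat_kernel_def case_prod_beta by (intro tendsto_add tendsto_const lim)
  qed
  interpret P: finite_measure "\<mu> \<Otimes>\<^sub>M \<mu>"
    by (rule finite_measure_pair_measure) (rule finite_measure_mu)+
  let ?h = "\<lambda>(x, y). heat_kernel W lam t x y"
  have "integrable (\<mu> \<Otimes>\<^sub>M \<mu>) (\<lambda>z. (norm (?h z))\<^sup>2)"
  proof (rule P.integrable_const_bound)
    show "AE z in \<mu> \<Otimes>\<^sub>M \<mu>. norm ((norm (?h z))\<^sup>2) \<le> (1 + infsum ?b W)\<^sup>2"
      using bound by (intro AE_I2) (auto intro!: power_mono split: prod.splits)
    show "(\<lambda>z. (norm (?h z))\<^sup>2) \<in> borel_measurable (\<mu> \<Otimes>\<^sub>M \<mu>)"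
      using meas by measurable
  qed
  with meas show "square_integrable (\<mu> \<Otimes>\<^sub>M \<mu>) ?h"
    by (simp add: square_integrable_def)
qed

end

theorem theorem3p13:
  fixes A :: "('x::t2_space, 'k::nonarch_local_field, 'n::finite) chart set"
    and H :: "('k ^ 'n) measure"
    and \<omega> :: "('x, 'k, 'n) chart \<Rightarrow> 'k ^ 'n \<Rightarrow> 'k"
    and \<mu> :: "'x measure"
    and \<pi> :: 'k and chi :: "'k \<Rightarrow> complex"
    and s \<rho> :: real
    and W :: "('x \<Rightarrow> complex) set"
    and lam :: "('x \<Rightarrow> complex) \<Rightarrow> real"
  assumes compact_X: "compact (UNIV :: 'x set)"
    and atlas: "analytic_atlas A" "finite A" "equalising A" "nerve_graph_connected A"
    and compact_domains: "\<forall>a\<in>A. compact (fst a)"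
    and haar: "haar_measure H"
    and form: "analytic_form A \<omega>" "nowhere_vanishing A \<omega>"
    and volume: "form_measure A H \<omega> \<mu>"
    and pi: "uniformiser \<pi>"
    and character: "additive_character chi"
      "\<forall>u\<in>int_ring. chi u = 1" "\<exists>u\<in>int_ring. chi (u / \<pi>) \<noteq> 1"
    and small: "\<rho> > 0" "non_overlapping (small_wavelets A \<pi> chi \<mu> \<rho>)"
    and basis: "W \<subseteq> wavelets A \<pi> chi \<mu>" "L2_orthonormal \<mu> W"
      "L2_closed_span \<mu> W = L2_closed_span \<mu> (small_wavelets A \<pi> chi \<mu> \<rho>)"
    and eigenvalue: "\<forall>\<psi>\<in>W. eigenvalue_for A \<mu> s \<psi> (lam \<psi>)"
  shows "(\<forall>t>0. \<forall>x y. x \<noteq> y \<longrightarrow> heat_term lam t x y summable_on W)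
    \<and> (s > 1 \<longrightarrow> (\<forall>t>0. (\<forall>x. heat_term lam t x x summable_on W)
         \<and> square_integrable (\<mu> \<Otimes>\<^sub>M \<mu>) (\<lambda>(x, y). heat_kernel W lam t x y)))"
proof -
  interpret wavelet_system H \<pi> A \<omega> \<mu> chi W
  proof
    show "haar_measure H" "uniformiser \<pi>" "analytic_atlas A" "finite A"
      "nowhere_vanishing A \<omega>" "form_measure A H \<omega> \<mu>" "additive_character chi"
      "\<exists>u\<in>int_ring. chi (u / \<pi>) \<noteq> 1" "W \<subseteq> wavelets A \<pi> chi \<mu>" "L2_orthonormal \<mu> W"
      by (fact assms)+
    show "compact (fst a)" if "a \<in> A" for a
      using compact_domains that by (rule bspec)
    show "K_analytic_on (\<omega> a) (snd a ` fst a)" if "a \<in> A" for a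
      using form(1) that by (simp add: analytic_form_def)
    show "chi u = 1" if "u \<in> int_ring" for u
      using character(2) that by (rule bspec)
  qed
  show ?thesis
  proof (intro conjI allI impI)
    fix t :: real assume "0 < t"
    fix x y :: 'x assume "x \<noteq> y"
    then show "heat_term lam t x y summable_on W"
      by (rule heat_terms_summable_off_diagonal)
  next
    fix t :: real assume "1 < s" "0 < t"
    note * = heat_kernel_exists_square_integrable[OF \<open>0 < t\<close> \<open>1 < s\<close> eigenvalue]
    show "heat_term lam t x x summable_on W" for x by (rule *(1))
    show "square_integrable (\<mu> \<Otimes>\<^sub>M \<mu>) (\<lambda>(x, y). heat_kernel W lam t x y)" by (rule *(2))
  qed
qed

end
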